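(* Let $G$ be a finite nonnilpotent group and let $\alpha$ be a faithful action of $G$ on a finite set $S$. Let $G^0=G\cup\{0\}$ and $S^0=S\cup\{0\}$ (each with a new element $0$), and define $\alpha^0:G^0\times S^0\to S^0$ by $\alpha^0(g,x)=gx$ if $g\in G$, $x\in S$, and $\alpha^0(g,x)=0$ otherwise. Let $\mathbf{C}$ be the algebra with universe $G^0\times S^0$ and two basic operations: a unary operation $f((g,x))=(g,\alpha^0(g,x))$ and a binary operation $d((g_1,x_1),(g_2,x_2))=(g_1,x_2)$. Then $\mathbf{C}$ is inherently nonfinitely based in the finite sense: for every $n\geq 1$ there exists $d\geq 1$ such that $\mathscr{V}(\mathbf{C})^{(n)}$ contains arbitrarily large finite $d$-generated algebras.
   Context: For a finite algebra $\mathbf{A}$ (with finitely many basic operations) and $n\geq 1$, $\mathscr{V}(\mathbf{A})^{(n)}$ denotes the class of all algebras (in the same signature) satisfying every identity in at most $n$ variables that is valid in $\mathbf{A}$. "Arbitrarily large finite $d$-generated algebras" means: for every $\ell>0$ there is a finite algebra in the class, generated by at most $d$ elements, with at least $\ell$ elements. (In the paper $\mathbf{C}$ is denoted $\mathbb{A}_0(G,S,\alpha)^\ast$.) *)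

theory Defs
  imports "HOL-Algebra.Group_Action" "HOL-Algebra.Generated_Groups"
begin

section \<open>Nilpotent groups\<close>

definition commutator_subgroup :: "('a, 'm) monoid_scheme \<Rightarrow> 'a set \<Rightarrow> 'a set \<Rightarrow> 'a set" where
  "commutator_subgroup G H K =
     generate G {h \<otimes>\<^bsub>G\<^esub> k \<otimes>\<^bsub>G\<^esub> inv\<^bsub>G\<^esub> h \<otimes>\<^bsub>G\<^esub> inv\<^bsub>G\<^esub> k | h k. h \<in> H \<and> k \<in> K}"

primrec lower_central_series :: "('a, 'm) monoid_scheme \<Rightarrow> nat \<Rightarrow> 'a set" where
  "lower_central_series G 0 = carrier G"
| "lower_central_series G (Suc i) = commutator_subgroup G (lower_central_series G i) (carrier G)"

definition nilpotent_group :: "('a, 'm) monoid_scheme \<Rightarrow> bool" where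
  "nilpotent_group G \<longleftrightarrow> group G \<and> (\<exists>c. lower_central_series G c = {\<one>\<^bsub>G\<^esub>})"

section \<open>Algebras, terms and identities\<close>

text \<open>
  A signature is an arity function on a type \<open>'f\<close> of operation symbols. The value of
  \<open>op_of A F xs\<close> is relevant only if \<open>xs\<close> is a list over the universe whose length is
  the arity of \<open>F\<close>.
\<close>

record ('f, 'a) ualgebra =
  universe :: "'a set"
  op_of :: "'f \<Rightarrow> 'a list \<Rightarrow> 'a"

definition is_ualgebra :: "('f \<Rightarrow> nat) \<Rightarrow> ('f, 'a) ualgebra \<Rightarrow> bool" where
  "is_ualgebra ar A \<longleftrightarrow> universe A \<noteq> {} \<and>
     (\<forall>F xs. length xs = ar F \<and> set xs \<subseteq> universe A \<longrightarrow> op_of A F xs \<in> universe A)"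

datatype ('f, 'v) uterm = Var 'v | App 'f "('f, 'v) uterm list"

primrec wf_uterm :: "('f \<Rightarrow> nat) \<Rightarrow> ('f, 'v) uterm \<Rightarrow> bool" where
  "wf_uterm ar (Var v) \<longleftrightarrow> True"
| "wf_uterm ar (App F ts) \<longleftrightarrow> length ts = ar F \<and> list_all (wf_uterm ar) ts"

primrec uterm_vars :: "('f, 'v) uterm \<Rightarrow> 'v set" where
  "uterm_vars (Var v) = {v}"
| "uterm_vars (App F ts) = \<Union> (set (map uterm_vars ts))"

primrec eval_uterm :: "('f, 'a) ualgebra \<Rightarrow> ('v \<Rightarrow> 'a) \<Rightarrow> ('f, 'v) uterm \<Rightarrow> 'a" where
  "eval_uterm A \<rho> (Var v) = \<rho> v"
| "eval_uterm A \<rho> (App F ts) = op_of A F (map (eval_uterm A \<rho>) ts)"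

definition satisfies_identity ::
    "('f, 'a) ualgebra \<Rightarrow> ('f, 'v) uterm \<Rightarrow> ('f, 'v) uterm \<Rightarrow> bool" where
  "satisfies_identity A s t \<longleftrightarrow>
     (\<forall>\<rho>. range \<rho> \<subseteq> universe A \<longrightarrow> eval_uterm A \<rho> s = eval_uterm A \<rho> t)"

text \<open>
  \<open>in_variety_upto ar n A B\<close> expresses that \<open>B\<close> belongs to
  \<open>V(A)\<^sup>(\<^sup>n\<^sup>)\<close>, the class of all algebras satisfying the identities in at most \<open>n\<close> variables
  valid in \<open>A\<close>.
\<close>

definition in_variety_upto ::
    "('f \<Rightarrow> nat) \<Rightarrow> nat \<Rightarrow> ('f, 'a) ualgebra \<Rightarrow> ('f, 'b) ualgebra \<Rightarrow> bool" where
  "in_variety_upto ar n A B \<longleftrightarrow> is_ualgebra ar B \<and>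
     (\<forall>(s :: ('f, nat) uterm) t.
        wf_uterm ar s \<and> wf_uterm ar t \<and> card (uterm_vars s \<union> uterm_vars t) \<le> n \<and>
        satisfies_identity A s t \<longrightarrow> satisfies_identity B s t)"

inductive_set subuniverse_generated ::
    "('f \<Rightarrow> nat) \<Rightarrow> ('f, 'a) ualgebra \<Rightarrow> 'a set \<Rightarrow> 'a set"
  for ar :: "'f \<Rightarrow> nat" and A :: "('f, 'a) ualgebra" and X :: "'a set" where
  gen: "x \<in> X \<Longrightarrow> x \<in> subuniverse_generated ar A X"
| app: "length xs = ar F \<Longrightarrow> \<forall>x\<in>set xs. x \<in> subuniverse_generated ar A X \<Longrightarrow>
          op_of A F xs \<in> subuniverse_generated ar A X"

definition generated_by_at_most :: "('f \<Rightarrow> nat) \<Rightarrow> ('f, 'a) ualgebra \<Rightarrow> nat \<Rightarrow> bool" where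
  "generated_by_at_most ar A d \<longleftrightarrow>
     (\<exists>X. X \<subseteq> universe A \<and> finite X \<and> card X \<le> d \<and> subuniverse_generated ar A X = universe A)"

text \<open>
  The quantification over finite algebras \<open>B\<close> is over algebras whose universe is a finite set of
  natural numbers; this loses nothing, since every finite algebra is isomorphic to such an algebra
  and all properties involved are invariant under isomorphism.
\<close>

definition inherently_nonfinitely_based_in_finite_sense ::
    "('f \<Rightarrow> nat) \<Rightarrow> ('f, 'a) ualgebra \<Rightarrow> bool" where
  "inherently_nonfinitely_based_in_finite_sense ar A \<longleftrightarrow>
     (\<forall>n\<ge>1. \<exists>d\<ge>1. \<forall>l>0. \<exists>B :: ('f, nat) ualgebra.
        in_variety_upto ar n A B \<and> finite (universe B) \<and>
        generated_by_at_most ar B d \<and> l \<le> card (universe B))"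

section \<open>The algebra of a group action\<close>

text \<open>The adjoined element 0 is \<open>None\<close>, both for \<open>G\<close> and for \<open>S\<close>.\<close>

definition with_zero :: "'a set \<Rightarrow> 'a option set" where
  "with_zero X = insert None (Some ` X)"

fun action_zero :: "('g \<Rightarrow> 's \<Rightarrow> 's) \<Rightarrow> 'g option \<Rightarrow> 's option \<Rightarrow> 's option" where
  "action_zero \<alpha> (Some g) (Some x) = Some (\<alpha> g x)"
| "action_zero \<alpha> _ _ = None"

datatype fd_symbol = Sym_f | Sym_d

primrec fd_arity :: "fd_symbol \<Rightarrow> nat" where
  "fd_arity Sym_f = 1"
| "fd_arity Sym_d = 2"

definition action_f ::
    "('g \<Rightarrow> 's \<Rightarrow> 's) \<Rightarrow> 'g option \<times> 's option \<Rightarrow> 'g option \<times> 's option" where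
  "action_f \<alpha> p = (fst p, action_zero \<alpha> (fst p) (snd p))"

definition action_d ::
    "'g option \<times> 's option \<Rightarrow> 'g option \<times> 's option \<Rightarrow> 'g option \<times> 's option" where
  "action_d p q = (fst p, snd q)"

definition action_algebra ::
    "('g, 'm) monoid_scheme \<Rightarrow> 's set \<Rightarrow> ('g \<Rightarrow> 's \<Rightarrow> 's) \<Rightarrow>
     (fd_symbol, 'g option \<times> 's option) ualgebra" where
  "action_algebra G S \<alpha> =
     \<lparr>universe = with_zero (carrier G) \<times> with_zero S,
      op_of = (\<lambda>F xs. case F of
         Sym_f \<Rightarrow> action_f \<alpha> (xs ! 0)
       | Sym_d \<Rightarrow> action_d (xs ! 0) (xs ! 1))\<rparr>"

lemma is_ualgebra_action_algebra:
  fixes G :: "('g, 'm) monoid_scheme" and S :: "'s set"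
  assumes "group_action G S \<alpha>"
  shows "is_ualgebra fd_arity (action_algebra G S \<alpha>)"
proof -
  have cl: "\<alpha> g x \<in> S" if "g \<in> carrier G" "x \<in> S" for g x
    using group_action.element_image[OF assms that] by simp
  have 1: "action_f \<alpha> p \<in> with_zero (carrier G) \<times> with_zero S"
    if "p \<in> with_zero (carrier G) \<times> with_zero S" for p
    using that by (auto simp: action_f_def with_zero_def inj_image_mem_iff cl)
  have 2: "action_d p q \<in> with_zero (carrier G) \<times> with_zero S"
    if "p \<in> with_zero (carrier G) \<times> with_zero S" "q \<in> with_zero (carrier G) \<times> with_zero S"
    for p q :: "'g option \<times> 's option"
    using that by (auto simp: action_d_def)
  show ?thesis
    unfolding is_ualgebra_def
  proof (intro conjI allI impI)
    show "universe (action_algebra G S \<alpha>) \<noteq> {}"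
      by (auto simp: action_algebra_def with_zero_def)
  next
    fix F xs
    assume h: "length xs = fd_arity F \<and> set xs \<subseteq> universe (action_algebra G S \<alpha>)"
    show "op_of (action_algebra G S \<alpha>) F xs \<in> universe (action_algebra G S \<alpha>)"
    proof (cases F)
      case Sym_f
      then have "xs ! 0 \<in> set xs" using h by simp
      then have "xs ! 0 \<in> with_zero (carrier G) \<times> with_zero S"
        using h by (auto simp: action_algebra_def)
      from 1[OF this] show ?thesis using Sym_f by (simp add: action_algebra_def)
    next
      case Sym_d
      then have "xs ! 0 \<in> set xs" "xs ! 1 \<in> set xs" using h by simp_all
      then have "xs ! 0 \<in> with_zero (carrier G) \<times> with_zero S"
        "xs ! 1 \<in> with_zero (carrier G) \<times> with_zero S"
        using h by (auto simp: action_algebra_def)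
      from 2[OF this] show ?thesis using Sym_d by (simp add: action_algebra_def)
    qed
  qed
qed

end

theory Submission
  imports Defs "HOL-Algebra.Sylow" "HOL-Algebra.Multiplicative_Group" "HOL-Algebra.SimpleGroups"
    "HOL-Algebra.Elementary_Groups" "HOL-Number_Theory.Cong"
begin

text \<open>
  Terms over the two operations amount to a head variable, a word of variables acting, and a tail
  variable, so the identities of the algebra yield the word identities of \<open>G\<close>. For given \<open>n\<close>
  it suffices to find, with a fixed number of letters, transitive actions on arbitrarily large
  finite sets in which any \<open>n\<close> of the letters satisfy the word identities of \<open>G\<close>.

  A finite nonnilpotent group has a section with an elementary abelian normal \<open>p\<close>-subgroup on which
  an element of \<open>q\<close>-power order, \<open>q \<noteq> p\<close>, acts nontrivially. By Fourier inversion every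
  word identity of \<open>G\<close> therefore holds in \<open>C\<^sub>p wr C\<^sub>q\<^sup>n\<close>. Now take \<open>D wr C\<^sub>q\<^sup>n\<close>, where \<open>D\<close> is a
  large finite group generated by two elements \<open>s\<close>, \<open>t\<close> of order \<open>p\<close>, with the letters \<open>X\<close> (\<open>s\<close> at
  coordinate \<open>0\<close>), \<open>Y\<close> (\<open>t\<close> at coordinate \<open>(1,\<dots>,1)\<close>) and the \<open>n\<close> generators \<open>Z i\<close> of \<open>C\<^sub>q\<^sup>n\<close>.
  Together they generate a group involving \<open>D\<close>, but as soon as one letter is omitted,
  the conjugates of \<open>X\<close> and \<open>Y\<close> that occur commute.
\<close>

section \<open>Nilpotent groups and their centers\<close>

definition center :: "('a, 'm) monoid_scheme \<Rightarrow> 'a set" where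
  "center G = {z \<in> carrier G. \<forall>x\<in>carrier G. z \<otimes>\<^bsub>G\<^esub> x = x \<otimes>\<^bsub>G\<^esub> z}"

lemma center_in_carrier: "z \<in> center G \<Longrightarrow> z \<in> carrier G"
  by (simp add: center_def)

lemma center_commute: "z \<in> center G \<Longrightarrow> x \<in> carrier G \<Longrightarrow> z \<otimes>\<^bsub>G\<^esub> x = x \<otimes>\<^bsub>G\<^esub> z"
  unfolding center_def by blast

lemma centerI:
  "z \<in> carrier G \<Longrightarrow> (\<And>x. x \<in> carrier G \<Longrightarrow> z \<otimes>\<^bsub>G\<^esub> x = x \<otimes>\<^bsub>G\<^esub> z) \<Longrightarrow> z \<in> center G"
  by (simp add: center_def)

context group
begin

lemma lower_central_series_subset: "lower_central_series G i \<subseteq> carrier G"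
proof (induction i)
  case (Suc i)
  then have "{h \<otimes> k \<otimes> inv h \<otimes> inv k |h k. h \<in> lower_central_series G i \<and> k \<in> carrier G} \<subseteq> carrier G"
    by auto
  then show ?case by (auto simp: commutator_subgroup_def dest: generate_in_carrier)
qed simp

lemma commutator_in_lower_central_series:
  "h \<in> lower_central_series G i \<Longrightarrow> k \<in> carrier G \<Longrightarrow>
     h \<otimes> k \<otimes> inv h \<otimes> inv k \<in> lower_central_series G (Suc i)"
  by (auto simp: commutator_subgroup_def intro: generate.incl)

lemma one_in_lower_central_series: "\<one> \<in> lower_central_series G i"
  by (cases i) (auto simp: commutator_subgroup_def intro: generate.one)

lemma lower_central_series_Suc_subset:
  assumes "subgroup M G"
    and "\<And>h k. h \<in> lower_central_series G i \<Longrightarrow> k \<in> carrier G \<Longrightarrow> h \<otimes> k \<otimes> inv h \<otimes> inv k \<in> M"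
  shows "lower_central_series G (Suc i) \<subseteq> M"
  unfolding lower_central_series.simps commutator_subgroup_def
  by (rule generate_subgroup_incl[OF _ assms(1)]) (use assms(2) in blast)

lemma commutator_eq_one_iff:
  assumes "x \<in> carrier G" "y \<in> carrier G"
  shows "x \<otimes> y \<otimes> inv x \<otimes> inv y = \<one> \<longleftrightarrow> x \<otimes> y = y \<otimes> x"
proof -
  have "x \<otimes> y \<otimes> inv x \<otimes> inv y = (x \<otimes> y) \<otimes> inv (y \<otimes> x)"
    using assms by (simp add: m_assoc inv_mult_group)
  then show ?thesis
    using assms by (metis inv_equality inv_inv m_closed inv_closed r_inv)
qed

lemma nilpotent_group_if_trivial:
  assumes "carrier G = {\<one>}"
  shows "nilpotent_group G"
proof -
  have "lower_central_series G 0 = {\<one>}" using assms by simp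
  then show ?thesis using is_group unfolding nilpotent_group_def by blast
qed

lemma nilpotent_group_obtain_commutators_in:
  assumes "nilpotent_group G" "\<one> \<in> K" "\<not> carrier G \<subseteq> K"
  obtains z where "z \<in> carrier G" "z \<notin> K" "\<And>x. x \<in> carrier G \<Longrightarrow> z \<otimes> x \<otimes> inv z \<otimes> inv x \<in> K"
proof -
  obtain c where "lower_central_series G c = {\<one>}"
    using assms(1) unfolding nilpotent_group_def by blast
  then have "lower_central_series G c \<subseteq> K" using assms(2) by simp
  moreover have "\<not> lower_central_series G 0 \<subseteq> K" using assms(3) by simp
  ultimately obtain j where j: "\<not> lower_central_series G j \<subseteq> K" "lower_central_series G (Suc j) \<subseteq> K"
    using ex_least_nat_less[of "\<lambda>i. lower_central_series G i \<subseteq> K" c] by blast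
  then obtain z where "z \<in> lower_central_series G j" "z \<notin> K" by blast
  then show thesis
    using that j(2) commutator_in_lower_central_series lower_central_series_subset by blast
qed

lemma nilpotent_group_normalizer_condition:
  assumes "nilpotent_group G" "subgroup H G" "H \<noteq> carrier G"
  obtains z where "z \<in> carrier G" "z \<notin> H" "\<And>x. x \<in> H \<Longrightarrow> z \<otimes> x \<otimes> inv z \<in> H"
proof -
  have "\<one> \<in> H" "\<not> carrier G \<subseteq> H"
    using assms(2,3) subgroup.one_closed subgroup.subset by blast+
  from nilpotent_group_obtain_commutators_in[OF assms(1) this]
  obtain z where z: "z \<in> carrier G" "z \<notin> H"
    "\<And>x. x \<in> carrier G \<Longrightarrow> z \<otimes> x \<otimes> inv z \<otimes> inv x \<in> H" by blast
  have "z \<otimes> x \<otimes> inv z \<in> H" if x: "x \<in> H" for x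
  proof -
    have xG: "x \<in> carrier G" using x assms(2) subgroup.mem_carrier by metis
    have "z \<otimes> x \<otimes> inv z \<otimes> inv x \<otimes> x \<in> H"
      using z(3)[OF xG] x assms(2) subgroup.m_closed by metis
    then show ?thesis using z(1) xG by (simp add: m_assoc)
  qed
  then show thesis using that z by blast
qed

lemma nilpotent_group_center_nontrivial:
  assumes "nilpotent_group G" "carrier G \<noteq> {\<one>}"
  shows "center G \<noteq> {\<one>}"
proof -
  have "\<not> carrier G \<subseteq> {\<one>}" using assms(2) one_closed by blast
  with nilpotent_group_obtain_commutators_in[OF assms(1), of "{\<one>}"]
  obtain z where "z \<in> carrier G" "z \<noteq> \<one>" "\<And>x. x \<in> carrier G \<Longrightarrow> z \<otimes> x \<otimes> inv z \<otimes> inv x = \<one>"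
    by auto
  then show ?thesis using commutator_eq_one_iff by (auto simp: center_def)
qed

lemma subgroup_center: "subgroup (center G) G"
proof (rule subgroupI)
  show "center G \<subseteq> carrier G" "center G \<noteq> {}" by (auto simp: center_def)
next
  fix a assume a: "a \<in> center G"
  have aG: "a \<in> carrier G" by (rule center_in_carrier[OF a])
  show "inv a \<in> center G"
  proof (rule centerI)
    fix x assume x: "x \<in> carrier G"
    have "inv (a \<otimes> inv x) = inv (inv x \<otimes> a)" using center_commute[OF a] x by simp
    then show "inv a \<otimes> x = x \<otimes> inv a" using aG x by (simp add: inv_mult_group)
  qed (use aG in simp)
next
  fix a b assume ab: "a \<in> center G" "b \<in> center G"
  then have carr: "a \<in> carrier G" "b \<in> carrier G" by (simp_all add: center_in_carrier)
  show "a \<otimes> b \<in> center G"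
  proof (rule centerI)
    fix x assume x: "x \<in> carrier G"
    have "a \<otimes> (b \<otimes> x) = x \<otimes> a \<otimes> b"
      using center_commute[OF ab(1) x] center_commute[OF ab(2) x] x carr
      by (simp add: m_assoc[symmetric])
    then show "a \<otimes> b \<otimes> x = x \<otimes> (a \<otimes> b)" using x carr by (simp add: m_assoc)
  qed (use carr in simp)
qed

lemma normal_center: "center G \<lhd> G"
proof (rule normal_invI[OF subgroup_center])
  fix x z assume x: "x \<in> carrier G" and z: "z \<in> center G"
  then have "x \<otimes> z \<otimes> inv x = z"
    using center_commute[OF z x] center_in_carrier[OF z] inv_solve_right' by simp
  then show "x \<otimes> z \<otimes> inv x \<in> center G" using z by simp
qed

end

context group_hom
begin

lemma subgroup_vimage:
  assumes "subgroup L H"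
  shows "subgroup {x \<in> carrier G. h x \<in> L} G"
proof (rule G.subgroupI)
  have "\<one> \<in> {x \<in> carrier G. h x \<in> L}" using subgroup.one_closed[OF assms] by simp
  then show "{x \<in> carrier G. h x \<in> L} \<noteq> {}" by blast
qed (auto simp: subgroup.m_closed[OF assms] subgroup.m_inv_closed[OF assms])

lemma normal_vimage:
  assumes "N \<lhd> H"
  shows "{x \<in> carrier G. h x \<in> N} \<lhd> G"
proof (rule G.normal_invI)
  show "subgroup {x \<in> carrier G. h x \<in> N} G"
    by (rule subgroup_vimage[OF normal_imp_subgroup[OF assms]])
next
  fix x y assume "x \<in> carrier G" "y \<in> {x \<in> carrier G. h x \<in> N}"
  then show "x \<otimes> y \<otimes> inv x \<in> {x \<in> carrier G. h x \<in> N}"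
    using normal.inv_op_closed2[OF assms] by simp
qed

lemma lower_central_series_subset_image:
  assumes "h ` carrier G = carrier H"
  shows "lower_central_series H i \<subseteq> h ` lower_central_series G i"
proof (induction i)
  case 0
  then show ?case using assms by simp
next
  case (Suc i)
  let ?K = "{x \<otimes> k \<otimes> inv x \<otimes> inv k |x k. x \<in> lower_central_series G i \<and> k \<in> carrier G}"
  have "y \<in> h ` ?K"
    if y: "y = x \<otimes>\<^bsub>H\<^esub> k \<otimes>\<^bsub>H\<^esub> inv\<^bsub>H\<^esub> x \<otimes>\<^bsub>H\<^esub> inv\<^bsub>H\<^esub> k"
      "x \<in> lower_central_series H i" "k \<in> carrier H" for y x k
  proof -
    obtain x' k' where lift: "x = h x'" "x' \<in> lower_central_series G i" "k = h k'" "k' \<in> carrier G"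
      using y(2,3) Suc assms by blast
    moreover have "x' \<in> carrier G" using lift(2) G.lower_central_series_subset by blast
    ultimately have "y = h (x' \<otimes> k' \<otimes> inv x' \<otimes> inv k')" using y(1) by simp
    then show ?thesis using lift(2,4) by blast
  qed
  then have "lower_central_series H (Suc i) \<subseteq> generate H (h ` ?K)"
    unfolding lower_central_series.simps commutator_subgroup_def
    by (intro H.mono_generate subsetI) blast
  moreover have "?K \<subseteq> carrier G" using G.lower_central_series_subset[of i] by auto
  ultimately show ?case using generate_img by (simp add: commutator_subgroup_def)
qed

lemma nilpotent_group_image:
  assumes "h ` carrier G = carrier H" "nilpotent_group G"
  shows "nilpotent_group H"
proof -
  obtain c where "lower_central_series G c = {\<one>}"
    using assms(2) unfolding nilpotent_group_def by blast
  then have "lower_central_series H c = {\<one>\<^bsub>H\<^esub>}"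
    using lower_central_series_subset_image[OF assms(1), of c] H.one_in_lower_central_series[of c]
    by auto
  then show ?thesis unfolding nilpotent_group_def using H.is_group by blast
qed

end

section \<open>A minimal nonnilpotent section\<close>

definition proper_subgroups_nilpotent :: "('a, 'm) monoid_scheme \<Rightarrow> bool" where
  "proper_subgroups_nilpotent G \<longleftrightarrow>
     (\<forall>H. subgroup H G \<longrightarrow> H \<noteq> carrier G \<longrightarrow> nilpotent_group (G\<lparr>carrier := H\<rparr>))"

lemma (in group_hom) proper_subgroups_nilpotent_image:
  assumes surj: "h ` carrier G = carrier H" and "proper_subgroups_nilpotent G"
  shows "proper_subgroups_nilpotent H"
  unfolding proper_subgroups_nilpotent_def
proof (intro allI impI)
  fix L assume L: "subgroup L H" "L \<noteq> carrier H"
  let ?K = "{x \<in> carrier G. h x \<in> L}"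
  have K: "subgroup ?K G" by (rule subgroup_vimage[OF L(1)])
  have image_K: "h ` ?K = L" using subgroup.subset[OF L(1)] surj by auto
  then have "?K \<noteq> carrier G" using L(2) surj by auto
  then have nil: "nilpotent_group (G\<lparr>carrier := ?K\<rparr>)"
    using assms(2) K unfolding proper_subgroups_nilpotent_def by blast
  interpret restricted: group_hom "G\<lparr>carrier := ?K\<rparr>" "H\<lparr>carrier := L\<rparr>" h
    using G.subgroup_imp_group[OF K] H.subgroup_imp_group[OF L(1)]
    by (auto simp: group_hom_def group_hom_axioms_def hom_def)
  show "nilpotent_group (H\<lparr>carrier := L\<rparr>)"
    by (rule restricted.nilpotent_group_image) (simp_all add: image_K nil)
qed

lemma (in normal) group_hom_Mod: "group_hom G (G Mod H) (\<lambda>x. H #> x)"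
  using r_coset_hom_Mod factorgroup_is_group
  by (simp add: group_hom_def group_hom_axioms_def is_group)

lemma image_r_coset_Mod: "(#>\<^bsub>G\<^esub>) H ` carrier G = carrier (G Mod H)"
  by (auto simp: FactGroup_def RCOSETS_def)

lemma (in group) minimal_nonnilpotent_subgroup_exists:
  assumes "finite (carrier G)" "\<not> nilpotent_group G"
  obtains H where "subgroup H G" "\<not> nilpotent_group (G\<lparr>carrier := H\<rparr>)"
    "proper_subgroups_nilpotent (G\<lparr>carrier := H\<rparr>)"
proof -
  let ?nonnilpotent = "{H. subgroup H G \<and> \<not> nilpotent_group (G\<lparr>carrier := H\<rparr>)}"
  have "finite ?nonnilpotent"
    by (rule finite_subset[of _ "Pow (carrier G)"]) (use assms(1) subgroup.subset in auto)
  moreover have "carrier G \<in> ?nonnilpotent" using assms(2) subgroup_self by simp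
  ultimately obtain H where H: "H \<in> ?nonnilpotent" "\<And>K. K \<in> ?nonnilpotent \<Longrightarrow> K \<subseteq> H \<Longrightarrow> H = K"
    by (meson finite_has_minimal2)
  have "proper_subgroups_nilpotent (G\<lparr>carrier := H\<rparr>)"
    unfolding proper_subgroups_nilpotent_def
  proof (intro allI impI)
    fix K assume K: "subgroup K (G\<lparr>carrier := H\<rparr>)" "K \<noteq> carrier (G\<lparr>carrier := H\<rparr>)"
    then have "subgroup K G" "K \<subseteq> H"
      using H(1) incl_subgroup subgroup.subset by fastforce+
    then show "nilpotent_group (G\<lparr>carrier := H\<rparr>\<lparr>carrier := K\<rparr>)" using H(2)[of K] K(2) by auto
  qed
  then show thesis using that H(1) by blast
qed

definition center_vimage :: "('a, 'm) monoid_scheme \<Rightarrow> 'a set \<Rightarrow> 'a set" where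
  "center_vimage G M = {x \<in> carrier G. M #>\<^bsub>G\<^esub> x \<in> center (G Mod M)}"

context normal
begin

lemma r_coset_eq_one_iff: "x \<in> carrier G \<Longrightarrow> H #> x = \<one>\<^bsub>G Mod H\<^esub> \<longleftrightarrow> x \<in> H"
  using is_subgroup coset_join1 coset_join2 unfolding FactGroup_def
  by (metis monoid.select_convs(2))

lemma normal_center_vimage: "center_vimage G H \<lhd> G"
  unfolding center_vimage_def
  by (rule group_hom.normal_vimage[OF group_hom_Mod group.normal_center[OF factorgroup_is_group]])

lemma subset_center_vimage: "H \<subseteq> center_vimage G H"
proof
  fix x assume x: "x \<in> H"
  then have "H #> x = \<one>\<^bsub>G Mod H\<^esub>" using r_coset_eq_one_iff subset by blast
  then show "x \<in> center_vimage G H"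
    using x subset subgroup.one_closed[OF group.subgroup_center[OF factorgroup_is_group]]
    by (auto simp: center_vimage_def)
qed

lemma lower_central_series_Suc_subset_if_subset_center_vimage:
  assumes "lower_central_series G c \<subseteq> center_vimage G H"
  shows "lower_central_series G (Suc c) \<subseteq> H"
proof (rule lower_central_series_Suc_subset[OF is_subgroup])
  fix x y assume x: "x \<in> lower_central_series G c" and y: "y \<in> carrier G"
  interpret proj: group_hom G "G Mod H" "(#>) H" by (rule group_hom_Mod)
  have xG: "x \<in> carrier G" and "H #> x \<in> center (G Mod H)"
    using x assms by (auto simp: center_vimage_def)
  then have "H #> (x \<otimes> y \<otimes> inv x \<otimes> inv y) = \<one>\<^bsub>G Mod H\<^esub>"
    using y proj.H.commutator_eq_one_iff[of "H #> x" "H #> y"] by (simp add: center_def)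
  moreover have "x \<otimes> y \<otimes> inv x \<otimes> inv y \<in> carrier G" using xG y by simp
  ultimately show "x \<otimes> y \<otimes> inv x \<otimes> inv y \<in> H" using r_coset_eq_one_iff by metis
qed

lemma center_Mod_trivial_if_center_vimage_eq:
  assumes "center_vimage G H = H"
  shows "center (G Mod H) = {\<one>\<^bsub>G Mod H\<^esub>}"
proof
  show "center (G Mod H) \<subseteq> {\<one>\<^bsub>G Mod H\<^esub>}"
  proof
    fix z assume z: "z \<in> center (G Mod H)"
    then have "z \<in> (#>) H ` carrier G" unfolding image_r_coset_Mod by (rule center_in_carrier)
    then obtain x where x: "x \<in> carrier G" "z = H #> x" by blast
    then have "x \<in> H" using z assms unfolding center_vimage_def by blast
    then show "z \<in> {\<one>\<^bsub>G Mod H\<^esub>}" using x r_coset_eq_one_iff by simp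
  qed
  show "{\<one>\<^bsub>G Mod H\<^esub>} \<subseteq> center (G Mod H)"
    using subgroup.one_closed[OF group.subgroup_center[OF factorgroup_is_group]] by simp
qed

lemma carrier_Mod_nontrivial:
  assumes "H \<noteq> carrier G"
  shows "carrier (G Mod H) \<noteq> {\<one>\<^bsub>G Mod H\<^esub>}"
proof
  assume "carrier (G Mod H) = {\<one>\<^bsub>G Mod H\<^esub>}"
  then have "H #> x = \<one>\<^bsub>G Mod H\<^esub>" if "x \<in> carrier G" for x
    using group_hom.hom_closed[OF group_hom_Mod that] by simp
  then show False using assms subset r_coset_eq_one_iff by blast
qed

end

text \<open>
  The normal subgroup \<open>M\<close> is maximal among those with a nonnilpotent quotient: the preimage of the
  center of \<open>G Mod M\<close> contains a term of the lower central series only if \<open>M\<close> contains the next one.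
\<close>

lemma (in group) centerless_nontrivial_quotient_exists:
  assumes "finite (carrier G)" "\<not> nilpotent_group G"
  obtains M where "M \<lhd> G" "carrier (G Mod M) \<noteq> {\<one>\<^bsub>G Mod M\<^esub>}" "center (G Mod M) = {\<one>\<^bsub>G Mod M\<^esub>}"
proof -
  let ?omits_series = "{M. M \<lhd> G \<and> (\<forall>c. \<not> lower_central_series G c \<subseteq> M)}"
  have "finite ?omits_series"
    by (rule finite_subset[of _ "Pow (carrier G)"])
      (use assms(1) normal_imp_subgroup subgroup.subset in blast)+
  moreover have "{\<one>} \<in> ?omits_series"
    using assms(2) is_group one_is_normal one_in_lower_central_series
    unfolding nilpotent_group_def by blast
  ultimately obtain M where M: "M \<in> ?omits_series" "\<And>K. K \<in> ?omits_series \<Longrightarrow> M \<subseteq> K \<Longrightarrow> M = K"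
    by (meson finite_has_maximal2)
  interpret M: normal M G using M(1) by blast
  have "center_vimage G M \<in> ?omits_series"
    using M(1) M.normal_center_vimage M.lower_central_series_Suc_subset_if_subset_center_vimage
    by blast
  then have "center_vimage G M = M" using M(2) M.subset_center_vimage by blast
  moreover have "M \<noteq> carrier G" using M(1) lower_central_series_subset by auto
  ultimately show thesis
    by (intro that[of M] M.normal_axioms M.carrier_Mod_nontrivial M.center_Mod_trivial_if_center_vimage_eq)
qed

section \<open>Conjugation and maximal subgroups\<close>

definition conj_by :: "('a, 'm) monoid_scheme \<Rightarrow> 'a \<Rightarrow> 'a \<Rightarrow> 'a" where
  "conj_by G g x = g \<otimes>\<^bsub>G\<^esub> x \<otimes>\<^bsub>G\<^esub> inv\<^bsub>G\<^esub> g"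

definition conjugates :: "('a, 'm) monoid_scheme \<Rightarrow> 'a set \<Rightarrow> 'a set set" where
  "conjugates G H = (\<lambda>g. conj_by G g ` H) ` carrier G"

definition conjugates_cover :: "('a, 'm) monoid_scheme \<Rightarrow> 'a set \<Rightarrow> 'a set" where
  "conjugates_cover G H = (\<Union>K\<in>conjugates G H. K - {\<one>\<^bsub>G\<^esub>})"

definition maximal_subgroup :: "('a, 'm) monoid_scheme \<Rightarrow> 'a set \<Rightarrow> bool" where
  "maximal_subgroup G M \<longleftrightarrow> subgroup M G \<and> M \<noteq> carrier G \<and>
     (\<forall>K. subgroup K G \<longrightarrow> M \<subseteq> K \<longrightarrow> K \<noteq> carrier G \<longrightarrow> K = M)"

context group
begin

lemma conj_by_closed [simp]: "g \<in> carrier G \<Longrightarrow> x \<in> carrier G \<Longrightarrow> conj_by G g x \<in> carrier G"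
  by (simp add: conj_by_def)

lemma conj_by_mult: "g \<in> carrier G \<Longrightarrow> x \<in> carrier G \<Longrightarrow> y \<in> carrier G \<Longrightarrow>
    conj_by G g (x \<otimes> y) = conj_by G g x \<otimes> conj_by G g y"
  by (simp add: conj_by_def m_assoc inv_solve_left)

lemma conj_by_conj_by: "g \<in> carrier G \<Longrightarrow> h \<in> carrier G \<Longrightarrow> x \<in> carrier G \<Longrightarrow>
    conj_by G g (conj_by G h x) = conj_by G (g \<otimes> h) x"
  by (simp add: conj_by_def m_assoc inv_mult_group)

lemma conj_by_one_left [simp]: "x \<in> carrier G \<Longrightarrow> conj_by G \<one> x = x"
  by (simp add: conj_by_def)

lemma conj_by_one_right [simp]: "g \<in> carrier G \<Longrightarrow> conj_by G g \<one> = \<one>"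
  by (simp add: conj_by_def)

lemma conj_by_inv: "g \<in> carrier G \<Longrightarrow> x \<in> carrier G \<Longrightarrow> conj_by G g (inv x) = inv (conj_by G g x)"
  by (simp add: conj_by_def m_assoc inv_mult_group)

lemma conj_by_eq_iff:
  "g \<in> carrier G \<Longrightarrow> x \<in> carrier G \<Longrightarrow> conj_by G g x = x \<longleftrightarrow> g \<otimes> x = x \<otimes> g"
  unfolding conj_by_def by (metis inv_solve_right' m_closed)

lemma inj_on_conj_by: "g \<in> carrier G \<Longrightarrow> inj_on (conj_by G g) (carrier G)"
  by (rule inj_on_inverseI[of _ "conj_by G (inv g)"]) (simp add: conj_by_conj_by)

lemma conj_by_image_image:
  "g \<in> carrier G \<Longrightarrow> h \<in> carrier G \<Longrightarrow> H \<subseteq> carrier G \<Longrightarrow>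
    conj_by G g ` conj_by G h ` H = conj_by G (g \<otimes> h) ` H"
  by (force simp: image_image conj_by_conj_by intro!: image_cong)

lemma conj_by_one_image: "H \<subseteq> carrier G \<Longrightarrow> conj_by G \<one> ` H = H"
  by (force simp: image_def)

lemma card_conj_by_image: "g \<in> carrier G \<Longrightarrow> H \<subseteq> carrier G \<Longrightarrow> card (conj_by G g ` H) = card H"
  using inj_on_conj_by inj_on_subset card_image by blast

lemma l_r_coset_eq_conj_by_image: "g <# H #> inv g = conj_by G g ` H"
  by (auto simp: l_coset_def r_coset_def conj_by_def)

lemma subgroup_conj_by_image: "g \<in> carrier G \<Longrightarrow> subgroup H G \<Longrightarrow> subgroup (conj_by G g ` H) G"
  using subgroup_conjugation_is_surj2 by (simp add: l_r_coset_eq_conj_by_image)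

lemma normalizer_iff:
  "H \<subseteq> carrier G \<Longrightarrow> g \<in> normalizer G H \<longleftrightarrow> g \<in> carrier G \<and> conj_by G g ` H = H"
  by (simp add: normalizer_def stabilizer_def l_r_coset_eq_conj_by_image)

lemma subgroup_subset_normalizer:
  assumes "subgroup H G"
  shows "H \<subseteq> normalizer G H"
proof
  fix g assume g: "g \<in> H"
  have "g \<in> carrier G" using g assms subgroup.mem_carrier by metis
  moreover have "g <# H #> inv g = H"
    using calculation g assms by (simp add: coset_join2 coset_join3 subgroup.m_inv_closed)
  ultimately show "g \<in> normalizer G H"
    using normalizer_iff[OF subgroup.subset[OF assms]] by (simp add: l_r_coset_eq_conj_by_image)
qed

lemma normal_if_normalizer_eq_carrier:
  assumes "subgroup H G" "normalizer G H = carrier G"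
  shows "H \<lhd> G"
proof (rule normal_invI[OF assms(1)])
  fix x h assume "x \<in> carrier G" "h \<in> H"
  then have "conj_by G x h \<in> H"
    using assms(2) normalizer_iff[OF subgroup.subset[OF assms(1)]] by blast
  then show "x \<otimes> h \<otimes> inv x \<in> H" by (simp add: conj_by_def)
qed

lemma psubset_normalizer_Int_nilpotent:
  assumes "subgroup D G" "finite D" "subgroup K G" "nilpotent_group (G\<lparr>carrier := K\<rparr>)" "D \<subset> K"
  shows "D \<subset> normalizer G D \<inter> K"
proof -
  interpret K: group "G\<lparr>carrier := K\<rparr>" by (rule subgroup_imp_group[OF assms(3)])
  have DG: "D \<subseteq> carrier G" by (rule subgroup.subset[OF assms(1)])
  have "subgroup D (G\<lparr>carrier := K\<rparr>)" using subgroup_incl assms(1,3,5) by blast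
  then obtain z where z: "z \<in> K" "z \<notin> D" "\<And>x. x \<in> D \<Longrightarrow> z \<otimes> x \<otimes> inv z \<in> D"
    using K.nilpotent_group_normalizer_condition[OF assms(4)] assms(5) m_inv_consistent[OF assms(3)]
    by auto
  have zG: "z \<in> carrier G" using z(1) assms(3) subgroup.mem_carrier by metis
  have "conj_by G z ` D \<subseteq> D" using z(3) by (auto simp: conj_by_def)
  then have "conj_by G z ` D = D"
    using assms(2) card_conj_by_image[OF zG DG] by (simp add: card_subset_eq)
  then have "z \<in> normalizer G D" using normalizer_iff[OF DG] zG by simp
  then show ?thesis using subgroup_subset_normalizer[OF assms(1)] assms(5) z(1,2) by blast
qed

lemma conjugates_eq_orbit:
  assumes "H \<subseteq> carrier G"
  shows "conjugates G H = orbit G (\<lambda>g. \<lambda>H\<in>{H. H \<subseteq> carrier G}. g <# H #> inv g) H"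
  using assms by (auto simp: conjugates_def orbit_def l_r_coset_eq_conj_by_image)

lemma card_conjugates:
  assumes "H \<subseteq> carrier G"
  shows "card (conjugates G H) * card (normalizer G H) = order G"
  unfolding conjugates_eq_orbit[OF assms] normalizer_def
  by (rule group_action.orbit_stabilizer_theorem[OF action_by_conjugation_on_power_set]) (use assms in simp)

lemma conjugates_sym:
  assumes "H \<subseteq> carrier G" "K \<in> conjugates G H"
  shows "H \<in> conjugates G K"
proof -
  obtain g where "g \<in> carrier G" "K = conj_by G g ` H" using assms(2) by (auto simp: conjugates_def)
  then have "H = conj_by G (inv g) ` K" "inv g \<in> carrier G"
    using assms(1) by (simp_all add: conj_by_image_image conj_by_one_image)
  then show ?thesis by (auto simp: conjugates_def)
qed

lemma conjugates_trans:
  assumes "H \<subseteq> carrier G" "K \<in> conjugates G H" "L \<in> conjugates G K"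
  shows "L \<in> conjugates G H"
  using assms conj_by_image_image by (auto simp: conjugates_def intro!: imageI)

lemma maximal_subgroup_subset: "maximal_subgroup G M \<Longrightarrow> M \<subseteq> carrier G"
  unfolding maximal_subgroup_def using subgroup.subset by auto

lemma maximal_subgroup_exists:
  assumes "finite (carrier G)" "subgroup H G" "H \<noteq> carrier G"
  obtains M where "maximal_subgroup G M" "H \<subseteq> M"
proof -
  let ?proper = "{K. subgroup K G \<and> K \<noteq> carrier G}"
  have "finite ?proper"
    by (rule finite_subset[of _ "Pow (carrier G)"]) (use assms(1) subgroup.subset in auto)
  moreover have "H \<in> ?proper" using assms(2,3) by simp
  ultimately obtain M where M: "M \<in> ?proper" "H \<subseteq> M" "\<And>K. K \<in> ?proper \<Longrightarrow> M \<subseteq> K \<Longrightarrow> M = K"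
    by (meson finite_has_maximal2)
  then have "maximal_subgroup G M" unfolding maximal_subgroup_def by blast
  then show thesis using that M(2) by blast
qed

lemma maximal_subgroup_conj_by:
  assumes M: "maximal_subgroup G M" and g: "g \<in> carrier G"
  shows "maximal_subgroup G (conj_by G g ` M)"
  unfolding maximal_subgroup_def
proof (intro conjI allI impI)
  have undo_conj: "conj_by G (inv g) ` conj_by G g ` H = H" "conj_by G g ` conj_by G (inv g) ` H = H"
    if "H \<subseteq> carrier G" for H
    using g that by (simp_all add: conj_by_image_image conj_by_one_image)
  have conj_carrier: "conj_by G h ` carrier G = carrier G" if "h \<in> carrier G" for h
    using that subgroup_subset_normalizer[OF subgroup_self] normalizer_iff[of "carrier G"] by blast
  have MG: "M \<subseteq> carrier G" by (rule maximal_subgroup_subset[OF M])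
  show "subgroup (conj_by G g ` M) G"
    using M g subgroup_conj_by_image by (simp add: maximal_subgroup_def)
  show "conj_by G g ` M \<noteq> carrier G"
    using M undo_conj(1)[OF MG] conj_carrier[of "inv g"] g by (auto simp: maximal_subgroup_def)
  fix K assume K: "subgroup K G" "conj_by G g ` M \<subseteq> K" "K \<noteq> carrier G"
  have KG: "K \<subseteq> carrier G" by (rule subgroup.subset[OF K(1)])
  have "M \<subseteq> conj_by G (inv g) ` K"
    using image_mono[OF K(2), of "conj_by G (inv g)"] undo_conj(1)[OF MG] by simp
  moreover have "conj_by G (inv g) ` K \<noteq> carrier G"
    using undo_conj(2)[OF KG] conj_carrier[OF g] K(3) by metis
  moreover have "subgroup (conj_by G (inv g) ` K) G" using subgroup_conj_by_image g K(1) by simp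
  ultimately have "conj_by G (inv g) ` K = M" using M unfolding maximal_subgroup_def by blast
  then show "K = conj_by G g ` M" using undo_conj(2)[OF KG] by simp
qed

lemma maximal_subgroup_conjugates:
  "maximal_subgroup G M \<Longrightarrow> K \<in> conjugates G M \<Longrightarrow> maximal_subgroup G K"
  using maximal_subgroup_conj_by by (auto simp: conjugates_def)

lemma card_conjugates_cover:
  assumes fin: "finite (carrier G)" and M: "subgroup M G"
    and trivial_Int: "\<And>K L. K \<in> conjugates G M \<Longrightarrow> L \<in> conjugates G M \<Longrightarrow> K \<noteq> L \<Longrightarrow> K \<inter> L = {\<one>}"
  shows "card (conjugates_cover G M) = card (conjugates G M) * (card M - 1)"
proof -
  have MG: "M \<subseteq> carrier G" by (rule subgroup.subset[OF M])
  have conjugate: "finite K" "card (K - {\<one>}) = card M - 1" if K: "K \<in> conjugates G M" for K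
  proof -
    obtain g where g: "g \<in> carrier G" "K = conj_by G g ` M" using K by (auto simp: conjugates_def)
    then have "subgroup K G" using subgroup_conj_by_image M by simp
    then show "finite K" using fin finite_subset subgroup.subset by metis
    then show "card (K - {\<one>}) = card M - 1"
      using g card_conj_by_image[OF g(1) MG] subgroup.one_closed[OF \<open>subgroup K G\<close>]
      by (simp add: card_Diff_singleton)
  qed
  have "card (conjugates_cover G M) = (\<Sum>K\<in>conjugates G M. card (K - {\<one>}))"
    unfolding conjugates_cover_def
  proof (rule card_UN_disjoint)
    show "finite (conjugates G M)" using fin by (simp add: conjugates_def)
  qed (use conjugate(1) trivial_Int in blast)+
  also have "\<dots> = card (conjugates G M) * (card M - 1)" using conjugate(2) by simp
  finally show ?thesis .
qed

end

lemma (in normal) conj_by_in: "g \<in> carrier G \<Longrightarrow> x \<in> H \<Longrightarrow> conj_by G g x \<in> H"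
  unfolding conj_by_def by (rule inv_op_closed2)

section \<open>A finite simple group with nilpotent proper subgroups is commutative\<close>

text \<open>
  Distinct maximal subgroups intersect trivially by the normalizer condition. Each of them is its
  own normalizer, so its conjugates cover at least half of the group but not all of it; two
  conjugacy classes would cover too much, and one does not cover enough.
\<close>

locale simple_group_nilpotent_subgroups = simple_group +
  assumes finite_carrier: "finite (carrier G)"
    and proper_subgroups_nilpotent: "proper_subgroups_nilpotent G"
begin

lemma maximal_subgroups_Int_trivial:
  assumes "maximal_subgroup G K" "maximal_subgroup G L" "K \<noteq> L"
  shows "K \<inter> L = {\<one>}"
  using assms
proof (induction "order G - card (K \<inter> L)" arbitrary: K L rule: less_induct)
  case less
  let ?D = "K \<inter> L"
  have KL: "subgroup K G" "K \<noteq> carrier G" "subgroup L G" "L \<noteq> carrier G"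
    using less.prems by (auto simp: maximal_subgroup_def)
  have D: "subgroup ?D G" by (rule subgroups_Inter_pair[OF KL(1,3)])
  have DG: "?D \<subseteq> carrier G" by (rule subgroup.subset[OF D])
  have finD: "finite ?D" by (rule finite_subset[OF DG finite_carrier])
  have "\<not> K \<subseteq> L" "\<not> L \<subseteq> K" using less.prems unfolding maximal_subgroup_def by metis+
  then have D_proper: "?D \<subset> K" "?D \<subset> L" by blast+
  show ?case
  proof (rule ccontr)
    assume nontrivial: "?D \<noteq> {\<one>}"
    have "?D \<noteq> carrier G" using D_proper(1) subgroup.subset[OF KL(1)] by blast
    then have "normalizer G ?D \<noteq> carrier G"
      using normal_if_normalizer_eq_carrier[OF D] no_real_normal_subgroup nontrivial by blast
    with maximal_subgroup_exists[OF finite_carrier normalizer_imp_subgroup[OF DG]]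
    obtain M where M: "maximal_subgroup G M" "normalizer G ?D \<subseteq> M" by blast
    have "M = J" if J: "maximal_subgroup G J" "?D \<subset> J" for J
    proof (rule ccontr)
      assume "M \<noteq> J"
      have J': "subgroup J G" "nilpotent_group (G\<lparr>carrier := J\<rparr>)"
        using J(1) proper_subgroups_nilpotent
        by (auto simp: maximal_subgroup_def proper_subgroups_nilpotent_def)
      have larger: "?D \<subset> M \<inter> J"
        using psubset_normalizer_Int_nilpotent[OF D finD J' J(2)] M(2) by blast
      have "M \<inter> J \<subseteq> carrier G" using maximal_subgroup_subset[OF M(1)] by blast
      then have "card ?D < card (M \<inter> J)" "card (M \<inter> J) \<le> order G"
        using larger finite_carrier finite_subset
        by (auto simp: order_def intro!: psubset_card_mono card_mono)
      then have "M \<inter> J = {\<one>}" using less.hyps[OF _ M(1) J(1) \<open>M \<noteq> J\<close>] by simp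
      then show False using larger subgroup.one_closed[OF D] by auto
    qed
    then show False using less.prems D_proper by metis
  qed
qed

lemma conjugates_Int_trivial:
  assumes "maximal_subgroup G M" "K \<in> conjugates G M" "maximal_subgroup G L" "K \<noteq> L"
  shows "K \<inter> L = {\<one>}"
  using assms maximal_subgroup_conjugates maximal_subgroups_Int_trivial by blast

lemma card_conjugates_cover_bounds:
  assumes M: "maximal_subgroup G M" "M \<noteq> {\<one>}"
  shows "order G \<le> 2 * card (conjugates_cover G M)" "card (conjugates_cover G M) < order G - 1"
proof -
  have sM: "subgroup M G" and "M \<noteq> carrier G" using M(1) by (auto simp: maximal_subgroup_def)
  have MG: "M \<subseteq> carrier G" by (rule maximal_subgroup_subset[OF M(1)])
  have finM: "finite M" by (rule finite_subset[OF MG finite_carrier])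
  have "normalizer G M \<noteq> carrier G"
    using normal_if_normalizer_eq_carrier[OF sM] no_real_normal_subgroup M(2) \<open>M \<noteq> carrier G\<close>
    by blast
  then have "normalizer G M = M"
    using M(1) normalizer_imp_subgroup[OF MG] subgroup_subset_normalizer[OF sM]
    unfolding maximal_subgroup_def by blast
  then have index: "card (conjugates G M) * card M = order G" using card_conjugates[OF MG] by simp
  have cover: "card (conjugates_cover G M) = card (conjugates G M) * (card M - 1)"
    by (rule card_conjugates_cover[OF finite_carrier sM])
      (use M(1) conjugates_Int_trivial maximal_subgroup_conjugates in blast)
  have "{\<one>} \<subset> M" using subgroup.one_closed[OF sM] M(2) by blast
  then have "card M > 1" using psubset_card_mono[OF finM, of "{\<one>}"] by simp
  then have "order G = card (conjugates_cover G M) + card (conjugates G M)"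
    "card (conjugates G M) \<le> card (conjugates_cover G M)"
    using index unfolding cover by (cases "card M"; simp)+
  moreover have "card M < order G"
    unfolding order_def using finite_carrier MG \<open>M \<noteq> carrier G\<close> by (intro psubset_card_mono) auto
  then have "card (conjugates G M) \<noteq> 0" "card (conjugates G M) \<noteq> 1"
    using index by (metis mult_0 not_less_zero, metis mult_1 less_irrefl)
  then have "card (conjugates G M) \<ge> 2" by simp
  ultimately show "order G \<le> 2 * card (conjugates_cover G M)"
    "card (conjugates_cover G M) < order G - 1"
    by linarith+
qed

lemma in_maximal_subgroup:
  assumes "\<not> comm_group G" "g \<in> carrier G"
  obtains M where "maximal_subgroup G M" "g \<in> M"
proof -
  have g: "subgroup (generate G {g}) G" using assms(2) by (intro generate_is_subgroup) auto
  have "generate G {g} \<noteq> carrier G"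
  proof
    assume "generate G {g} = carrier G"
    then have "carrier G = range (\<lambda>k::int. g [^] k)"
      using generate_pow[OF assms(2)] by (simp add: full_SetCompr_eq)
    then show False using cyclic_group cyclic_imp_abelian_group assms by blast
  qed
  then obtain M where "maximal_subgroup G M" "generate G {g} \<subseteq> M"
    using maximal_subgroup_exists[OF finite_carrier g] by blast
  then show thesis using that generate.incl[of g "{g}"] by blast
qed

lemma conjugates_cover_subset: "maximal_subgroup G M \<Longrightarrow> conjugates_cover G M \<subseteq> carrier G - {\<one>}"
  using maximal_subgroup_conjugates maximal_subgroup_subset unfolding conjugates_cover_def by blast

lemma conjugates_cover_Int_empty:
  assumes M: "maximal_subgroup G M" and L: "maximal_subgroup G L" and "L \<notin> conjugates G M"
  shows "conjugates_cover G M \<inter> conjugates_cover G L = {}"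
proof (rule ccontr)
  assume "conjugates_cover G M \<inter> conjugates_cover G L \<noteq> {}"
  then obtain x K J where KJ: "K \<in> conjugates G M" "J \<in> conjugates G L" "x \<in> K \<inter> J" "x \<noteq> \<one>"
    unfolding conjugates_cover_def by blast
  then have "K = J"
    using conjugates_Int_trivial[OF M] maximal_subgroup_conjugates[OF L] by blast
  then have "L \<in> conjugates G K"
    using conjugates_sym[OF maximal_subgroup_subset[OF L] KJ(2)] by simp
  then have "L \<in> conjugates G M"
    by (rule conjugates_trans[OF maximal_subgroup_subset[OF M] KJ(1)])
  then show False using assms(3) by simp
qed

lemma is_comm_group: "comm_group G"
proof (rule ccontr)
  assume noncomm: "\<not> comm_group G"
  have finite_nonidentity: "finite (carrier G - {\<one>})" using finite_carrier by simp
  obtain g where g: "g \<in> carrier G" "g \<noteq> \<one>" using simple_not_triv one_closed by blast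
  then obtain M where M: "maximal_subgroup G M" "M \<noteq> {\<one>}"
    using in_maximal_subgroup[OF noncomm g(1)] by blast
  have "card (conjugates_cover G M) < card (carrier G - {\<one>})"
    using card_conjugates_cover_bounds(2)[OF M] by (simp add: order_def card_Diff_singleton)
  then have "conjugates_cover G M \<subset> carrier G - {\<one>}" using conjugates_cover_subset[OF M(1)] by auto
  then obtain h where h: "h \<in> carrier G" "h \<noteq> \<one>" "h \<notin> conjugates_cover G M" by blast
  obtain L where L: "maximal_subgroup G L" "h \<in> L" using in_maximal_subgroup[OF noncomm h(1)] .
  have "L \<notin> conjugates G M" using h(2,3) L(2) unfolding conjugates_cover_def by blast
  then have "card (conjugates_cover G M) + card (conjugates_cover G L) =
      card (conjugates_cover G M \<union> conjugates_cover G L)"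
    using conjugates_cover_Int_empty[OF M(1) L(1)] conjugates_cover_subset M(1) L(1)
      finite_nonidentity finite_subset
    by (intro card_Un_disjoint[symmetric]) blast+
  also have "\<dots> \<le> card (carrier G - {\<one>})"
    using conjugates_cover_subset M(1) L(1) by (intro card_mono[OF finite_nonidentity]) blast
  also have "\<dots> < order G" using order_gt_one by (simp add: order_def card_Diff_singleton)
  finally have "card (conjugates_cover G M) + card (conjugates_cover G L) < order G" .
  moreover have "L \<noteq> {\<one>}" using L(2) h(2) by blast
  ultimately show False
    using card_conjugates_cover_bounds(1)[OF M] card_conjugates_cover_bounds(1)[OF L(1)] by linarith
qed

end

lemma (in group) proper_nontrivial_normal_subgroup_exists:
  assumes "finite (carrier G)" "carrier G \<noteq> {\<one>}" "center G = {\<one>}" "proper_subgroups_nilpotent G"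
  obtains N where "N \<lhd> G" "N \<noteq> {\<one>}" "N \<noteq> carrier G"
proof (rule ccontr)
  assume "\<not> thesis"
  then have no_normal: "\<And>N. N \<lhd> G \<Longrightarrow> N = carrier G \<or> N = {\<one>}" using that by blast
  have "{\<one>} \<subset> carrier G" using assms(2) one_closed by blast
  then have "order G > 1" using psubset_card_mono[OF assms(1), of "{\<one>}"] by (simp add: order_def)
  then interpret simple_group_nilpotent_subgroups G
    using no_normal assms(1,4) by unfold_locales auto
  have "center G = carrier G"
    using comm_group.axioms(1)[OF is_comm_group] comm_monoid.m_comm by (fastforce simp: center_def)
  then show False using assms(2,3) by simp
qed

section \<open>A noncentral coprime action on an elementary abelian normal subgroup\<close>

context group_action
begin

lemma group_action_restrict_invariant:
  assumes "B \<subseteq> E" and invariant: "\<And>g x. g \<in> carrier G \<Longrightarrow> x \<in> B \<Longrightarrow> \<phi> g x \<in> B"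
  shows "group_action G B (\<lambda>g. restrict (\<phi> g) B)"
proof -
  interpret group G by (rule group_hom.axioms(1)[OF group_hom])
  have inverse: "\<phi> g (\<phi> (inv g) x) = x" "\<phi> (inv g) (\<phi> g x) = x" if "g \<in> carrier G" "x \<in> B" for g x
    using that assms(1) orbit_sym_aux[of g x] orbit_sym_aux[of "inv g" x] by auto
  have Bij: "restrict (\<phi> g) B \<in> Bij B" if "g \<in> carrier G" for g
  proof -
    have "bij_betw (\<phi> g) B B"
      by (rule bij_betwI[where g = "\<phi> (inv g)"]) (use that invariant inverse in auto)
    then show ?thesis by (simp add: Bij_def)
  qed
  have "restrict (\<phi> (g \<otimes> h)) B = compose B (restrict (\<phi> g) B) (restrict (\<phi> h) B)"
    if "g \<in> carrier G" "h \<in> carrier G" for g h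
    using that invariant assms(1) composition_rule by (auto simp: compose_def intro!: restrict_ext)
  then show ?thesis
    unfolding group_action_def group_hom_def group_hom_axioms_def
    using Bij group_BijGroup by (auto simp: BijGroup_def intro!: homI)
qed

lemma prime_power_element_moves:
  assumes fin: "finite (carrier G)" and x: "x \<in> E" and r: "prime r" "r dvd card (orbit G \<phi> x)"
  obtains g k where "g \<in> carrier G" "g [^] (r ^ k :: nat) = \<one>" "\<phi> g x \<noteq> x"
proof (rule ccontr)
  assume "\<not> thesis"
  interpret group G by (rule group_hom.axioms(1)[OF group_hom])
  let ?S = "stabilizer G \<phi> x"
  have "order G \<noteq> 0" using fin order_gt_0_iff_finite by simp
  then obtain m where m: "order G = r ^ multiplicity r (order G) * m" "\<not> r dvd m"
    using multiplicity_decompose'[of "order G" r] r(1) by (metis not_prime_unit)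
  define k where "k = multiplicity r (order G)"
  obtain R where R: "subgroup R G" "card R = r ^ k"
    using sylow_thm[OF r(1) is_group m(1) fin] unfolding k_def by blast
  have "R \<subseteq> ?S"
  proof
    fix g assume g: "g \<in> R"
    then have "g \<in> carrier G" using R(1) subgroup.mem_carrier by metis
    moreover have "g [^] (r ^ k) = \<one>"
      using group.pow_order_eq_1[OF subgroup_imp_group[OF R(1)], of g] g R(2)
      by (simp add: order_def nat_pow_consistent[symmetric])
    ultimately show "g \<in> ?S" using that \<open>\<not> thesis\<close> unfolding stabilizer_def by blast
  qed
  then have "subgroup R (G\<lparr>carrier := ?S\<rparr>)"
    using subgroup_incl R(1) stabilizer_subgroup[OF x] by blast
  then have "r ^ k dvd card ?S"
    using group.lagrange[OF subgroup_imp_group[OF stabilizer_subgroup[OF x]]] R(2)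
    by (simp add: order_def) (metis dvd_triv_right)
  then have "r * r ^ k dvd r ^ k * m"
    using r(2) orbit_stabilizer_theorem[OF x] m(1) unfolding k_def by (metis mult_dvd_mono)
  then show False using m(2) r(1) by (simp add: prime_gt_0_nat mult.commute)
qed

lemma second_orbit_not_dvd:
  assumes "finite E" "prime p" "p dvd card E" and x: "x \<in> E" "orbit G \<phi> x = {x}"
  obtains y where "y \<in> E" "y \<noteq> x" "\<not> p dvd card (orbit G \<phi> y)"
proof (rule ccontr)
  assume "\<not> thesis"
  then have dvd: "\<And>y. y \<in> E \<Longrightarrow> y \<noteq> x \<Longrightarrow> p dvd card (orbit G \<phi> y)" using that by blast
  have orbits: "orbits G E \<phi> = orbit G \<phi> ` E" by (auto simp: orbits_def)
  then have "card E = (\<Sum>B\<in>orbits G E \<phi>. card B)"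
    using disjoint_sum[OF assms(1), of "\<lambda>_. 1::nat"] by simp
  also have "\<dots> = card {x} + (\<Sum>B\<in>orbits G E \<phi> - {{x}}. card B)"
    by (rule sum.remove) (use assms(1) x in \<open>auto simp: orbits intro: image_eqI[of _ _ x]\<close>)
  finally have card_E: "card E = 1 + (\<Sum>B\<in>orbits G E \<phi> - {{x}}. card B)" by simp
  have "p dvd (\<Sum>B\<in>orbits G E \<phi> - {{x}}. card B)"
  proof (rule dvd_sum)
    fix B assume "B \<in> orbits G E \<phi> - {{x}}"
    then obtain y where "y \<in> E" "B = orbit G \<phi> y" "y \<noteq> x" using x(2) by (auto simp: orbits)
    then show "p dvd card B" using dvd by simp
  qed
  then have "p dvd 1" using card_E assms(3) by (metis dvd_add_left_iff)
  then show False using assms(2) by simp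
qed

end

definition elementary_abelian :: "('a, 'm) monoid_scheme \<Rightarrow> nat \<Rightarrow> 'a set \<Rightarrow> bool" where
  "elementary_abelian G p A \<longleftrightarrow> prime p \<and> subgroup A G \<and> (\<forall>x\<in>A. x [^]\<^bsub>G\<^esub> p = \<one>\<^bsub>G\<^esub>) \<and>
     (\<forall>x\<in>A. \<forall>y\<in>A. x \<otimes>\<^bsub>G\<^esub> y = y \<otimes>\<^bsub>G\<^esub> x)"

context group
begin

lemma nat_pow_eq_iff_cong:
  assumes "x \<in> carrier G"
  shows "x [^] (m::nat) = x [^] (n::nat) \<longleftrightarrow> [m = n] (mod ord x)"
proof -
  have "x [^] m = x [^] n \<longleftrightarrow> int (ord x) dvd int n - int m"
    using int_pow_eq[OF assms, of "int m" "int n"] by (simp add: int_pow_int)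
  also have "\<dots> \<longleftrightarrow> [m = n] (mod ord x)"
    by (metis cong_iff_dvd_diff cong_int_iff cong_sym_eq)
  finally show ?thesis .
qed

lemma ord_eq_prime:
  assumes "x \<in> carrier G" "prime p" "x [^] p = \<one>" "x \<noteq> \<one>"
  shows "ord x = p"
  using assms pow_eq_id ord_eq_1 prime_nat_iff by metis

lemma prime_dvd_card_elementary_abelian:
  assumes "elementary_abelian G p A" "A \<noteq> {\<one>}"
  shows "p dvd card A"
proof -
  have A: "prime p" "subgroup A G" "\<And>x. x \<in> A \<Longrightarrow> x [^] p = \<one>"
    using assms(1) by (auto simp: elementary_abelian_def)
  interpret A: group "G\<lparr>carrier := A\<rparr>" by (rule subgroup_imp_group[OF A(2)])
  obtain x where x: "x \<in> A" "x \<noteq> \<one>" using assms(2) subgroup.one_closed[OF A(2)] by blast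
  then have "A.ord x = p" using A(1,3) A.ord_eq_prime[of x p] by (simp flip: nat_pow_consistent)
  then show ?thesis using A.ord_dvd_group_order[of x] x(1) by (simp add: order_def)
qed

lemma comm_group_elementary_abelian:
  assumes "elementary_abelian G p A"
  shows "comm_group (G\<lparr>carrier := A\<rparr>)"
  using assms group.group_comm_groupI[OF subgroup_imp_group] by (simp add: elementary_abelian_def)

lemma group_action_conj_by_normal:
  assumes "A \<lhd> G"
  shows "group_action G A (\<lambda>g. \<lambda>x\<in>A. conj_by G g x)"
proof -
  interpret A: normal A G by (rule assms)
  interpret conjugation: group_action G "carrier G" "\<lambda>g. \<lambda>x\<in>carrier G. g \<otimes> x \<otimes> inv g"
    by (rule action_by_conjugation)
  have "group_action G A (\<lambda>g. restrict (\<lambda>x\<in>carrier G. g \<otimes> x \<otimes> inv g) A)"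
    by (rule conjugation.group_action_restrict_invariant)
      (use A.subset A.inv_op_closed2 in \<open>auto simp: subset_iff\<close>)
  moreover have "carrier G \<inter> A = A" using A.subset by blast
  ultimately show ?thesis by (simp add: conj_by_def)
qed

lemma noncentralizing_prime_power_element_exists:
  assumes fin: "finite (carrier G)" and center: "center G = {\<one>}"
    and A: "A \<lhd> G" and p: "prime p" "p dvd card A"
  obtains q k g a where "prime q" "q \<noteq> p" "g \<in> carrier G" "g [^] (q ^ k :: nat) = \<one>"
    "a \<in> A" "g \<otimes> a \<noteq> a \<otimes> g"
proof -
  interpret A: normal A G by (rule A)
  let ?\<phi> = "\<lambda>g. \<lambda>x\<in>A. conj_by G g x"
  interpret action: group_action G A ?\<phi> by (rule group_action_conj_by_normal[OF A])
  have finA: "finite A" using A.subset fin finite_subset by blast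
  have "orbit G ?\<phi> \<one> = {\<one>}"
    using conj_by_one_right one_closed by (auto simp: orbit_def intro!: exI[of _ \<one>])
  with action.second_orbit_not_dvd[OF finA p A.one_closed]
  obtain a where a: "a \<in> A" "a \<noteq> \<one>" "\<not> p dvd card (orbit G ?\<phi> a)" .
  have aG: "a \<in> carrier G" using a(1) A.subset by blast
  have "card (orbit G ?\<phi> a) \<noteq> 1"
  proof
    assume "card (orbit G ?\<phi> a) = 1"
    then have "orbit G ?\<phi> a = {a}" using action.orbit_refl[OF a(1)] card_1_singletonE by force
    then have "conj_by G g a = a" if "g \<in> carrier G" for g
      using that a(1) by (auto simp: orbit_def)
    then have "a \<in> center G" using aG conj_by_eq_iff unfolding center_def by fastforce
    then show False using center a(2) by simp
  qed
  then obtain q where q: "prime q" "q dvd card (orbit G ?\<phi> a)" using prime_factor_nat by blast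
  from action.prime_power_element_moves[OF fin a(1) q]
  obtain g k where g: "g \<in> carrier G" "g [^] (q ^ k :: nat) = \<one>" "?\<phi> g a \<noteq> a" .
  have "g \<otimes> a \<noteq> a \<otimes> g" using g(1,3) a(1) aG conj_by_eq_iff by simp
  moreover have "q \<noteq> p" using a(3) q(2) by blast
  ultimately show thesis using that q(1) g(1,2) a(1) by blast
qed

lemma normal_center_of_normal:
  assumes "N \<lhd> G"
  shows "center (G\<lparr>carrier := N\<rparr>) \<lhd> G"
proof -
  interpret N: normal N G by (rule assms)
  interpret restricted: group "G\<lparr>carrier := N\<rparr>" by (rule subgroup_imp_group[OF N.is_subgroup])
  have center: "z \<in> center (G\<lparr>carrier := N\<rparr>) \<longleftrightarrow> z \<in> N \<and> (\<forall>x\<in>N. z \<otimes> x = x \<otimes> z)" for z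
    by (simp add: center_def)
  show ?thesis
  proof (rule normal_invI)
    show "subgroup (center (G\<lparr>carrier := N\<rparr>)) G"
      using incl_subgroup[OF N.is_subgroup restricted.subgroup_center] .
    fix g z assume g: "g \<in> carrier G" and z: "z \<in> center (G\<lparr>carrier := N\<rparr>)"
    then have zN: "z \<in> N" by (simp add: center)
    have "conj_by G g z \<otimes> x = x \<otimes> conj_by G g z" if x: "x \<in> N" for x
    proof -
      let ?y = "conj_by G (inv g) x"
      have y: "?y \<in> N" using N.conj_by_in g x by simp
      then have "conj_by G g (z \<otimes> ?y) = conj_by G g (?y \<otimes> z)" using z center by simp
      then show ?thesis using g x y zN N.mem_carrier by (simp add: conj_by_mult conj_by_conj_by)
    qed
    then show "g \<otimes> z \<otimes> inv g \<in> center (G\<lparr>carrier := N\<rparr>)"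
      using N.conj_by_in[OF g zN] by (simp add: center conj_by_def)
  qed
qed

lemma conj_by_nat_pow:
  "g \<in> carrier G \<Longrightarrow> x \<in> carrier G \<Longrightarrow> conj_by G g (x [^] (k::nat)) = conj_by G g x [^] k"
  by (induction k) (simp_all add: conj_by_mult)

lemma normal_commutative_exponent:
  assumes "Z \<lhd> G" and comm: "\<And>x y. x \<in> Z \<Longrightarrow> y \<in> Z \<Longrightarrow> x \<otimes> y = y \<otimes> x"
  shows "{x \<in> Z. x [^] (p::nat) = \<one>} \<lhd> G"
proof (rule normal_invI)
  interpret Z: normal Z G by (rule assms(1))
  show "subgroup {x \<in> Z. x [^] p = \<one>} G"
  proof (rule subgroupI)
    have "\<one> \<in> {x \<in> Z. x [^] p = \<one>}" by simp
    then show "{x \<in> Z. x [^] p = \<one>} \<noteq> {}" by blast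
  qed (use comm Z.subset in \<open>auto simp: nat_pow_inv pow_mult_distrib\<close>)
  fix g x assume "g \<in> carrier G" "x \<in> {x \<in> Z. x [^] p = \<one>}"
  then have "conj_by G g x \<in> {x \<in> Z. x [^] p = \<one>}"
    using Z.conj_by_in by (simp add: conj_by_nat_pow[symmetric])
  then show "g \<otimes> x \<otimes> inv g \<in> {x \<in> Z. x [^] p = \<one>}" by (simp add: conj_by_def)
qed

lemma elementary_abelian_normal_subgroup_exists:
  assumes fin: "finite (carrier G)" and N: "N \<lhd> G" "N \<noteq> {\<one>}" "nilpotent_group (G\<lparr>carrier := N\<rparr>)"
  obtains A p where "A \<lhd> G" "elementary_abelian G p A" "A \<noteq> {\<one>}"
proof -
  interpret N: normal N G by (rule N(1))
  interpret restricted: group "G\<lparr>carrier := N\<rparr>" by (rule subgroup_imp_group[OF N.is_subgroup])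
  let ?Z = "center (G\<lparr>carrier := N\<rparr>)"
  have Z: "?Z \<lhd> G" by (rule normal_center_of_normal[OF N(1)])
  interpret Z: normal ?Z G by (rule Z)
  have comm: "x \<otimes> y = y \<otimes> x" if "x \<in> ?Z" "y \<in> ?Z" for x y
    using center_commute[OF that(1)] center_in_carrier[OF that(2)] by simp
  have "?Z \<noteq> {\<one>}" using restricted.nilpotent_group_center_nontrivial[OF N(3)] N(2) by simp
  then obtain z where z: "z \<in> ?Z" "z \<noteq> \<one>" using Z.one_closed by blast
  have zG: "z \<in> carrier G" using z(1) Z.subset by blast
  have "ord z \<noteq> 1" using ord_eq_1[OF zG] z(2) by simp
  then obtain p where p: "prime p" "p dvd ord z" using prime_factor_nat by blast
  let ?A = "{x \<in> ?Z. x [^] p = \<one>}"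
  have A: "?A \<lhd> G" using normal_commutative_exponent[OF Z] comm by blast
  then have "elementary_abelian G p ?A"
    using p(1) comm normal_imp_subgroup unfolding elementary_abelian_def by blast
  moreover have "z [^] (ord z div p) \<in> ?A"
    using subgroup_int_pow_closed[OF Z.is_subgroup z(1), of "int (ord z div p)"] zG p(2)
    by (simp add: int_pow_int nat_pow_pow)
  moreover have "z [^] (ord z div p) \<noteq> \<one>"
  proof -
    have "ord z > 0" using ord_ge_1[OF fin zG] by simp
    then have "ord (z [^] (ord z div p)) = p"
      using ord_pow[OF zG, of "ord z div p"] p by (auto simp: dvd_div_eq_0_iff)
    then show ?thesis using p(1) by auto
  qed
  ultimately show thesis using that[OF A] by blast
qed

end

locale coprime_conjugation = normal A G for A and G (structure) +
  fixes p q :: nat and g a :: 'a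
  assumes elementary_abelian: "elementary_abelian G p A"
    and prime_q: "prime q" and p_neq_q: "p \<noteq> q"
    and g_closed [simp]: "g \<in> carrier G" and a_in: "a \<in> A"
    and not_commute: "g \<otimes> a \<noteq> a \<otimes> g"
    and pow_commute: "g [^] q \<otimes> a = a \<otimes> g [^] q"

lemma (in group) coprime_conjugation_exists:
  assumes fin: "finite (carrier G)" and "carrier G \<noteq> {\<one>}"
    and center: "center G = {\<one>}" and nilpotent: "proper_subgroups_nilpotent G"
  obtains A p q g a where "coprime_conjugation A G p q g a"
proof -
  from proper_nontrivial_normal_subgroup_exists[OF assms]
  obtain N where N: "N \<lhd> G" "N \<noteq> {\<one>}" "N \<noteq> carrier G" .
  have "nilpotent_group (G\<lparr>carrier := N\<rparr>)"
    using nilpotent N normal_imp_subgroup unfolding proper_subgroups_nilpotent_def by blast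
  from elementary_abelian_normal_subgroup_exists[OF fin N(1,2) this]
  obtain A p where A: "A \<lhd> G" "elementary_abelian G p A" "A \<noteq> {\<one>}" .
  have "prime p" "p dvd card A"
    using A prime_dvd_card_elementary_abelian by (auto simp: elementary_abelian_def)
  from noncentralizing_prime_power_element_exists[OF fin center A(1) this]
  obtain q k g a where g: "prime q" "q \<noteq> p" "g \<in> carrier G" "g [^] (q ^ k :: nat) = \<one>" "a \<in> A"
    "g \<otimes> a \<noteq> a \<otimes> g" .
  have aG: "a \<in> carrier G" using g(5) A(1) normal_imp_subgroup subgroup.mem_carrier by metis
  let ?commutes = "\<lambda>j. g [^] (q ^ j) \<otimes> a = a \<otimes> g [^] (q ^ j)"
  have "\<not> ?commutes 0" "?commutes k" using g(3,4,6) aG by simp_all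
  then obtain j where j: "\<not> ?commutes j" "?commutes (Suc j)"
    using ex_least_nat_less[of ?commutes k] by blast
  have "g [^] (q ^ Suc j) = (g [^] (q ^ j)) [^] q"
    using g(3) by (simp add: nat_pow_pow mult.commute)
  then have "coprime_conjugation A G p q (g [^] (q ^ j)) a"
    using A(1,2) g(1,2,3,5) j by (simp add: coprime_conjugation_def coprime_conjugation_axioms_def)
  then show thesis by (rule that)
qed

section \<open>Transport of algebras along injections\<close>

definition image_ualgebra :: "('b \<Rightarrow> 'c) \<Rightarrow> ('f, 'b) ualgebra \<Rightarrow> ('f, 'c) ualgebra" where
  "image_ualgebra h B =
     \<lparr>universe = h ` universe B,
      op_of = (\<lambda>F xs. h (op_of B F (map (inv_into (universe B) h) xs)))\<rparr>"

lemma eval_uterm_in_universe: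
  assumes "is_ualgebra ar B" "range \<rho> \<subseteq> universe B" "wf_uterm ar t"
  shows "eval_uterm B \<rho> t \<in> universe B"
  using assms(3)
proof (induction t)
  case (Var v)
  then show ?case using assms(2) by auto
next
  case (App F ts)
  then have "set (map (eval_uterm B \<rho>) ts) \<subseteq> universe B" by (auto simp: list_all_iff)
  then show ?case using App.prems assms(1) by (auto simp: is_ualgebra_def)
qed

lemma eval_uterm_image_ualgebra:
  assumes B: "is_ualgebra ar B" and h: "inj_on h (universe B)"
    and range: "range \<rho> \<subseteq> h ` universe B" and t: "wf_uterm ar t"
  shows "eval_uterm (image_ualgebra h B) \<rho> t
       = h (eval_uterm B (inv_into (universe B) h \<circ> \<rho>) t)"
  using t
proof (induction t)
  case (Var v)
  have "\<rho> v \<in> h ` universe B" using range by auto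
  then show ?case by (simp add: f_inv_into_f)
next
  case (App F ts)
  have range': "range (inv_into (universe B) h \<circ> \<rho>) \<subseteq> universe B"
    using range by (auto intro!: inv_into_into)
  have "inv_into (universe B) h (eval_uterm (image_ualgebra h B) \<rho> t)
      = eval_uterm B (inv_into (universe B) h \<circ> \<rho>) t" if "t \<in> set ts" for t
  proof -
    have "wf_uterm ar t" using App.prems that by (simp add: list_all_iff)
    then show ?thesis
      using App.IH[OF that] inv_into_f_f[OF h eval_uterm_in_universe[OF B range']] by metis
  qed
  then have "map (inv_into (universe B) h) (map (eval_uterm (image_ualgebra h B) \<rho>) ts)
      = map (eval_uterm B (inv_into (universe B) h \<circ> \<rho>)) ts"
    by simp
  moreover have "op_of (image_ualgebra h B) F xs = h (op_of B F (map (inv_into (universe B) h) xs))"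
    for xs
    by (simp add: image_ualgebra_def)
  ultimately show ?case by (simp only: eval_uterm.simps)
qed

lemma is_ualgebra_image_ualgebra:
  assumes "is_ualgebra ar B"
  shows "is_ualgebra ar (image_ualgebra h B)"
  unfolding is_ualgebra_def
proof (intro conjI allI impI)
  show "universe (image_ualgebra h B) \<noteq> {}"
    using assms by (auto simp: is_ualgebra_def image_ualgebra_def)
next
  fix F xs
  assume xs: "length xs = ar F \<and> set xs \<subseteq> universe (image_ualgebra h B)"
  then have "set (map (inv_into (universe B) h) xs) \<subseteq> universe B"
    by (auto simp: image_ualgebra_def intro!: inv_into_into)
  then show "op_of (image_ualgebra h B) F xs \<in> universe (image_ualgebra h B)"
    using xs assms unfolding image_ualgebra_def is_ualgebra_def by simp
qed

lemma in_variety_upto_image_ualgebra: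
  assumes "in_variety_upto ar n A B" "inj_on h (universe B)"
  shows "in_variety_upto ar n A (image_ualgebra h B)"
proof -
  have B: "is_ualgebra ar B" using assms(1) by (simp add: in_variety_upto_def)
  have "satisfies_identity (image_ualgebra h B) s t"
    if identity: "satisfies_identity B s t" "wf_uterm ar s" "wf_uterm ar t"
    for s t :: "('a, nat) uterm"
    unfolding satisfies_identity_def
  proof (intro allI impI)
    fix \<rho> :: "nat \<Rightarrow> 'd" assume "range \<rho> \<subseteq> universe (image_ualgebra h B)"
    then have range: "range \<rho> \<subseteq> h ` universe B" by (simp add: image_ualgebra_def)
    then have "range (inv_into (universe B) h \<circ> \<rho>) \<subseteq> universe B"
      by (auto intro!: inv_into_into)
    then show "eval_uterm (image_ualgebra h B) \<rho> s = eval_uterm (image_ualgebra h B) \<rho> t"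
      using identity
      by (simp add: eval_uterm_image_ualgebra[OF B assms(2) range] satisfies_identity_def)
  qed
  then show ?thesis
    using assms(1) is_ualgebra_image_ualgebra[OF B] unfolding in_variety_upto_def by blast
qed

lemma subuniverse_generated_subset_universe:
  assumes "is_ualgebra ar A" "X \<subseteq> universe A"
  shows "subuniverse_generated ar A X \<subseteq> universe A"
proof
  fix x assume "x \<in> subuniverse_generated ar A X"
  then show "x \<in> universe A"
  proof induction
    case (gen x)
    then show ?case using assms(2) by blast
  next
    case (app xs F)
    then show ?case using assms(1) by (auto simp: is_ualgebra_def)
  qed
qed

lemma image_subuniverse_generated_subset:
  assumes "is_ualgebra ar B" "inj_on h (universe B)" "X \<subseteq> universe B"
  shows "h ` subuniverse_generated ar B X \<subseteq> subuniverse_generated ar (image_ualgebra h B) (h ` X)"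
proof (rule image_subsetI)
  fix x assume "x \<in> subuniverse_generated ar B X"
  then show "h x \<in> subuniverse_generated ar (image_ualgebra h B) (h ` X)"
  proof induction
    case (gen x)
    then show ?case by (auto intro: subuniverse_generated.gen)
  next
    case (app xs F)
    have "op_of (image_ualgebra h B) F (map h xs) \<in>
        subuniverse_generated ar (image_ualgebra h B) (h ` X)"
      using app by (intro subuniverse_generated.app) auto
    moreover have "set xs \<subseteq> universe B"
      using app subuniverse_generated_subset_universe[OF assms(1,3)] by blast
    then have "map (inv_into (universe B) h) (map h xs) = xs"
      using assms(2) by (auto intro!: map_idI)
    ultimately show ?case by (simp add: image_ualgebra_def)
  qed
qed

lemma generated_by_at_most_image_ualgebra:
  assumes B: "is_ualgebra ar B" and h: "inj_on h (universe B)" and "generated_by_at_most ar B d"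
  shows "generated_by_at_most ar (image_ualgebra h B) d"
proof -
  obtain X where X: "X \<subseteq> universe B" "finite X" "card X \<le> d"
    "subuniverse_generated ar B X = universe B"
    using assms(3) unfolding generated_by_at_most_def by blast
  have universe: "universe (image_ualgebra h B) = h ` universe B" by (simp add: image_ualgebra_def)
  have "subuniverse_generated ar (image_ualgebra h B) (h ` X) \<subseteq> h ` universe B"
    using subuniverse_generated_subset_universe[OF is_ualgebra_image_ualgebra[OF B], of "h ` X" h] X(1)
    by (simp add: universe image_mono)
  moreover have "h ` universe B \<subseteq> subuniverse_generated ar (image_ualgebra h B) (h ` X)"
    using image_subuniverse_generated_subset[OF B h X(1)] X(4) by simp
  moreover have "card (h ` X) \<le> d" using X(2,3) card_image_le le_trans by blast
  ultimately show ?thesis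
    unfolding generated_by_at_most_def universe using X(1,2)
    by (intro exI[of _ "h ` X"]) auto
qed

lemma inherently_nonfinitely_based_in_finite_senseI:
  fixes A :: "('f, 'a) ualgebra"
  assumes "\<And>n. d n \<ge> 1"
    and "\<And>n l. \<exists>B :: ('f, 'b) ualgebra. in_variety_upto ar n A B \<and> finite (universe B) \<and>
      generated_by_at_most ar B (d n) \<and> l \<le> card (universe B)"
  shows "inherently_nonfinitely_based_in_finite_sense ar A"
proof -
  have "\<exists>B :: ('f, nat) ualgebra. in_variety_upto ar n A B \<and> finite (universe B) \<and>
      generated_by_at_most ar B (d n) \<and> l \<le> card (universe B)" for n l
  proof -
    obtain B :: "('f, 'b) ualgebra" where B: "in_variety_upto ar n A B" "finite (universe B)"
      "generated_by_at_most ar B (d n)" "l \<le> card (universe B)"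
      using assms(2) by blast
    obtain h :: "'b \<Rightarrow> nat" where h: "inj_on h (universe B)"
      using finite_imp_inj_to_nat_seg[OF B(2)] by blast
    have "is_ualgebra ar B" using B(1) by (simp add: in_variety_upto_def)
    moreover have "finite (universe (image_ualgebra h B))" "l \<le> card (universe (image_ualgebra h B))"
      using B h by (simp_all add: image_ualgebra_def card_image)
    ultimately show ?thesis
      using in_variety_upto_image_ualgebra[OF B(1) h] generated_by_at_most_image_ualgebra[OF _ h B(3)]
      by blast
  qed
  then show ?thesis
    unfolding inherently_nonfinitely_based_in_finite_sense_def using assms(1) by blast
qed

section \<open>Identities of the algebra of an action\<close>

definition pair_algebra :: "'p set \<Rightarrow> 'q set \<Rightarrow> ('p \<Rightarrow> 'q \<Rightarrow> 'q) \<Rightarrow> (fd_symbol, 'p \<times> 'q) ualgebra" where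
  "pair_algebra P Q act =
     \<lparr>universe = P \<times> Q,
      op_of = (\<lambda>F xs. case F of
         Sym_f \<Rightarrow> (fst (xs ! 0), act (fst (xs ! 0)) (snd (xs ! 0)))
       | Sym_d \<Rightarrow> (fst (xs ! 0), snd (xs ! 1)))\<rparr>"

lemma action_algebra_eq_pair_algebra:
  "action_algebra G S \<alpha> = pair_algebra (with_zero (carrier G)) (with_zero S) (action_zero \<alpha>)"
  unfolding action_algebra_def pair_algebra_def action_f_def action_d_def by simp

text \<open>
  Modulo the identities of rectangular bands, every term has the normal form
  \<open>d(h, f(d(v\<^sub>1, f(d(v\<^sub>2, \<dots> z)))))\<close> with variables \<open>h\<close>, \<open>v\<^sub>i\<close>, \<open>z\<close>; these are its head,
  its word and its tail.
\<close>

fun term_head :: "(fd_symbol, 'v) uterm \<Rightarrow> 'v" where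
  "term_head (Var v) = v"
| "term_head (App Sym_f [t]) = term_head t"
| "term_head (App Sym_d [s, t]) = term_head s"

fun term_tail :: "(fd_symbol, 'v) uterm \<Rightarrow> 'v" where
  "term_tail (Var v) = v"
| "term_tail (App Sym_f [t]) = term_tail t"
| "term_tail (App Sym_d [s, t]) = term_tail t"

fun term_word :: "(fd_symbol, 'v) uterm \<Rightarrow> 'v list" where
  "term_word (Var v) = []"
| "term_word (App Sym_f [t]) = term_head t # term_word t"
| "term_word (App Sym_d [s, t]) = term_word t"

lemma wf_fd_term_induct [consumes 1, case_names Var f d]:
  assumes "wf_uterm fd_arity t"
    and "\<And>v. P (Var v)"
    and "\<And>t. wf_uterm fd_arity t \<Longrightarrow> P t \<Longrightarrow> P (App Sym_f [t])"
    and "\<And>s t. wf_uterm fd_arity s \<Longrightarrow> wf_uterm fd_arity t \<Longrightarrow> P s \<Longrightarrow> P t \<Longrightarrow> P (App Sym_d [s, t])"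
  shows "P t"
  using assms(1)
proof (induction t)
  case (Var v)
  show ?case by (rule assms(2))
next
  case (App F ts)
  show ?case
  proof (cases F)
    case Sym_f
    with App.prems obtain t where "ts = [t]" by (auto simp: length_Suc_conv)
    then show ?thesis using App Sym_f assms(3) by simp
  next
    case Sym_d
    with App.prems obtain s t where "ts = [s, t]" by (auto simp: length_Suc_conv numeral_2_eq_2)
    then show ?thesis using App Sym_d assms(4) by simp
  qed
qed

lemma term_head_in_uterm_vars: "wf_uterm fd_arity t \<Longrightarrow> term_head t \<in> uterm_vars t"
  by (induction rule: wf_fd_term_induct) auto

lemma set_term_word_subset: "wf_uterm fd_arity t \<Longrightarrow> set (term_word t) \<subseteq> uterm_vars t"
  by (induction rule: wf_fd_term_induct) (auto simp: term_head_in_uterm_vars)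

lemma finite_uterm_vars: "finite (uterm_vars t)"
  by (induction t) auto

lemma eval_pair_algebra:
  assumes "wf_uterm fd_arity t"
  shows "eval_uterm (pair_algebra P Q act) \<rho> t =
    (fst (\<rho> (term_head t)),
     foldr act (map (fst \<circ> \<rho>) (term_word t)) (snd (\<rho> (term_tail t))))"
  using assms by (induction rule: wf_fd_term_induct) (auto simp: pair_algebra_def)

lemma satisfies_identity_pair_algebra_iff:
  fixes s t :: "(fd_symbol, 'v) uterm" and P :: "'p set" and Q :: "'q set"
  assumes wf: "wf_uterm fd_arity s" "wf_uterm fd_arity t"
  shows "satisfies_identity (pair_algebra P Q act) s t \<longleftrightarrow>
    (\<forall>\<gamma> \<xi>. range \<gamma> \<subseteq> P \<longrightarrow> range \<xi> \<subseteq> Q \<longrightarrow> \<gamma> (term_head s) = \<gamma> (term_head t) \<and>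
      foldr act (map \<gamma> (term_word s)) (\<xi> (term_tail s)) =
      foldr act (map \<gamma> (term_word t)) (\<xi> (term_tail t)))" (is "?identity \<longleftrightarrow> (\<forall>\<gamma> \<xi>. ?split \<gamma> \<xi>)")
proof
  assume identity: ?identity
  show "\<forall>\<gamma> \<xi>. ?split \<gamma> \<xi>"
  proof (intro allI impI)
    fix \<gamma> :: "'v \<Rightarrow> 'p" and \<xi> :: "'v \<Rightarrow> 'q"
    assume "range \<gamma> \<subseteq> P" "range \<xi> \<subseteq> Q"
    then have "range (\<lambda>v. (\<gamma> v, \<xi> v)) \<subseteq> universe (pair_algebra P Q act)"
      by (auto simp: pair_algebra_def)
    then have "eval_uterm (pair_algebra P Q act) (\<lambda>v. (\<gamma> v, \<xi> v)) s =
        eval_uterm (pair_algebra P Q act) (\<lambda>v. (\<gamma> v, \<xi> v)) t"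
      using identity unfolding satisfies_identity_def by blast
    then show "\<gamma> (term_head s) = \<gamma> (term_head t) \<and>
      foldr act (map \<gamma> (term_word s)) (\<xi> (term_tail s)) =
      foldr act (map \<gamma> (term_word t)) (\<xi> (term_tail t))"
      by (simp add: eval_pair_algebra wf comp_def)
  qed
next
  assume split: "\<forall>\<gamma> \<xi>. ?split \<gamma> \<xi>"
  show ?identity
    unfolding satisfies_identity_def eval_pair_algebra[OF wf(1)] eval_pair_algebra[OF wf(2)]
  proof (intro allI impI)
    fix \<rho> :: "'v \<Rightarrow> 'p \<times> 'q" assume "range \<rho> \<subseteq> universe (pair_algebra P Q act)"
    then have "range (fst \<circ> \<rho>) \<subseteq> P" "range (snd \<circ> \<rho>) \<subseteq> Q"
      by (auto simp: pair_algebra_def image_subset_iff mem_Times_iff)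
    then have "?split (fst \<circ> \<rho>) (snd \<circ> \<rho>)" using split by blast
    then show "(fst (\<rho> (term_head s)),
          foldr act (map (fst \<circ> \<rho>) (term_word s)) (snd (\<rho> (term_tail s)))) =
        (fst (\<rho> (term_head t)),
          foldr act (map (fst \<circ> \<rho>) (term_word t)) (snd (\<rho> (term_tail t))))"
      using \<open>range (fst \<circ> \<rho>) \<subseteq> P\<close> \<open>range (snd \<circ> \<rho>) \<subseteq> Q\<close> by simp
  qed
qed

lemma term_head_eq_if_satisfies_identity_pair_algebra:
  fixes s t :: "(fd_symbol, 'v) uterm"
  assumes "wf_uterm fd_arity s" "wf_uterm fd_arity t"
    and "satisfies_identity (pair_algebra P Q act) s t"
    and p: "p \<in> P" "p' \<in> P" "p \<noteq> p'" and "y \<in> Q"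
  shows "term_head s = term_head t"
proof (rule ccontr)
  assume "term_head s \<noteq> term_head t"
  let ?\<gamma> = "\<lambda>v. if v = term_head s then p else p'" and ?\<xi> = "\<lambda>_ :: 'v. y"
  have "range ?\<gamma> \<subseteq> P" "range ?\<xi> \<subseteq> Q" using p \<open>y \<in> Q\<close> by auto
  then have "?\<gamma> (term_head s) = ?\<gamma> (term_head t)"
    using assms(3) unfolding satisfies_identity_pair_algebra_iff[OF assms(1,2)] by blast
  then show False using p(3) \<open>term_head s \<noteq> term_head t\<close> by simp
qed

lemma is_ualgebra_pair_algebra:
  assumes "P \<noteq> {}" "Q \<noteq> {}" "\<And>p q. p \<in> P \<Longrightarrow> q \<in> Q \<Longrightarrow> act p q \<in> Q"
  shows "is_ualgebra fd_arity (pair_algebra P Q act)"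
  unfolding is_ualgebra_def
proof (intro conjI allI impI)
  show "universe (pair_algebra P Q act) \<noteq> {}" using assms by (auto simp: pair_algebra_def)
next
  fix F xs
  assume args: "length xs = fd_arity F \<and> set xs \<subseteq> universe (pair_algebra P Q act)"
  show "op_of (pair_algebra P Q act) F xs \<in> universe (pair_algebra P Q act)"
  proof (cases F)
    case Sym_f
    then obtain x where "xs = [x]" using args by (auto simp: length_Suc_conv)
    then show ?thesis using args Sym_f assms(3) by (auto simp: pair_algebra_def)
  next
    case Sym_d
    then obtain x y where "xs = [x, y]" using args by (auto simp: length_Suc_conv numeral_2_eq_2)
    then show ?thesis using args Sym_d by (auto simp: pair_algebra_def)
  qed
qed

inductive_set reachable :: "'p set \<Rightarrow> ('p \<Rightarrow> 'q \<Rightarrow> 'q) \<Rightarrow> 'q \<Rightarrow> 'q set"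
  for P :: "'p set" and act :: "'p \<Rightarrow> 'q \<Rightarrow> 'q" and q0 :: 'q where
  start: "q0 \<in> reachable P act q0"
| step: "p \<in> P \<Longrightarrow> q \<in> reachable P act q0 \<Longrightarrow> act p q \<in> reachable P act q0"

lemma generated_by_at_most_pair_algebra:
  assumes "finite P" "P \<noteq> {}" "q0 \<in> Q" "\<And>p q. p \<in> P \<Longrightarrow> q \<in> Q \<Longrightarrow> act p q \<in> Q"
    and "Q \<subseteq> reachable P act q0"
  shows "generated_by_at_most fd_arity (pair_algebra P Q act) (card P)"
proof -
  let ?A = "pair_algebra P Q act"
  let ?gen = "subuniverse_generated fd_arity ?A (P \<times> {q0})"
  have gen_f: "(p, act p q) \<in> ?gen" if "(p, q) \<in> ?gen" for p q
    using subuniverse_generated.app[of "[(p, q)]" fd_arity Sym_f ?A "P \<times> {q0}"] that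
    by (simp add: pair_algebra_def)
  have gen_d: "(p, q') \<in> ?gen" if "(p, q) \<in> ?gen" "(p', q') \<in> ?gen" for p q p' q'
    using subuniverse_generated.app[of "[(p, q), (p', q')]" fd_arity Sym_d ?A "P \<times> {q0}"] that
    by (simp add: pair_algebra_def)
  have gen_start: "(p, q0) \<in> ?gen" if "p \<in> P" for p
    using that by (auto intro: subuniverse_generated.gen)
  have "(p, q) \<in> ?gen" if "q \<in> reachable P act q0" "p \<in> P" for p q
    using that
  proof (induction arbitrary: p)
    case start
    then show ?case by (rule gen_start)
  next
    case (step p' q)
    then show ?case using gen_d[OF gen_start[OF step.prems] gen_f] by blast
  qed
  then have "P \<times> Q \<subseteq> ?gen" using assms(5) by blast
  moreover have "?gen \<subseteq> universe ?A"
    using is_ualgebra_pair_algebra[of P Q act] assms(2,3,4)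
    by (intro subuniverse_generated_subset_universe) (auto simp: pair_algebra_def)
  ultimately show ?thesis
    unfolding generated_by_at_most_def using assms(1,3)
    by (intro exI[of _ "P \<times> {q0}"]) (auto simp: pair_algebra_def card_cartesian_product)
qed

section \<open>Word identities\<close>

definition word_value :: "('a, 'm) monoid_scheme \<Rightarrow> ('v \<Rightarrow> 'a) \<Rightarrow> 'v list \<Rightarrow> 'a" where
  "word_value G \<sigma> w = foldr (\<otimes>\<^bsub>G\<^esub>) (map \<sigma> w) \<one>\<^bsub>G\<^esub>"

definition word_identity :: "('a, 'm) monoid_scheme \<Rightarrow> 'v list \<Rightarrow> 'v list \<Rightarrow> bool" where
  "word_identity G w w' \<longleftrightarrow> (\<forall>\<sigma>. range \<sigma> \<subseteq> carrier G \<longrightarrow> word_value G \<sigma> w = word_value G \<sigma> w')"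

lemma word_value_Nil [simp]: "word_value G \<sigma> [] = \<one>\<^bsub>G\<^esub>"
  by (simp add: word_value_def)

lemma word_value_Cons [simp]: "word_value G \<sigma> (v # w) = \<sigma> v \<otimes>\<^bsub>G\<^esub> word_value G \<sigma> w"
  by (simp add: word_value_def)

lemma word_identityD:
  "word_identity G w w' \<Longrightarrow> range \<sigma> \<subseteq> carrier G \<Longrightarrow> word_value G \<sigma> w = word_value G \<sigma> w'"
  by (simp add: word_identity_def)

lemma word_identity_map:
  fixes f :: "'v \<Rightarrow> 'u"
  assumes "word_identity G w w'"
  shows "word_identity G (map f w) (map f w')"
  unfolding word_identity_def
proof (intro allI impI)
  fix \<sigma> :: "'u \<Rightarrow> _" assume "range \<sigma> \<subseteq> carrier G"
  then have "range (\<sigma> \<circ> f) \<subseteq> carrier G" by auto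
  from word_identityD[OF assms this] show "word_value G \<sigma> (map f w) = word_value G \<sigma> (map f w')"
    by (simp add: word_value_def)
qed

lemma (in group) word_value_closed: "range \<sigma> \<subseteq> carrier G \<Longrightarrow> word_value G \<sigma> w \<in> carrier G"
  by (induction w) auto

lemma word_identity_subgroup:
  fixes w w' :: "'v list"
  assumes "subgroup H G" "word_identity G w w'"
  shows "word_identity (G\<lparr>carrier := H\<rparr>) w w'"
  unfolding word_identity_def
proof (intro allI impI)
  fix \<sigma> :: "'v \<Rightarrow> _" assume "range \<sigma> \<subseteq> carrier (G\<lparr>carrier := H\<rparr>)"
  then have "range \<sigma> \<subseteq> carrier G" using subgroup.subset[OF assms(1)] by simp
  from word_identityD[OF assms(2) this]
  show "word_value (G\<lparr>carrier := H\<rparr>) \<sigma> w = word_value (G\<lparr>carrier := H\<rparr>) \<sigma> w'"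
    by (simp add: word_value_def)
qed

lemma (in group_hom) hom_word_value:
  "range \<sigma> \<subseteq> carrier G \<Longrightarrow> h (word_value G \<sigma> w) = word_value H (h \<circ> \<sigma>) w"
proof (induction w)
  case (Cons v w)
  moreover have "\<sigma> v \<in> carrier G" using Cons.prems by auto
  ultimately show ?case using G.word_value_closed[OF Cons.prems] by simp
qed simp

lemma (in group_hom) word_identity_image:
  fixes w w' :: "'v list"
  assumes surj: "h ` carrier G = carrier H" and "word_identity G w w'"
  shows "word_identity H w w'"
  unfolding word_identity_def
proof (intro allI impI)
  fix \<sigma> :: "'v \<Rightarrow> _" assume \<sigma>: "range \<sigma> \<subseteq> carrier H"
  define \<tau> where "\<tau> = inv_into (carrier G) h \<circ> \<sigma>"
  have "range \<tau> \<subseteq> carrier G" "h \<circ> \<tau> = \<sigma>"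
    using \<sigma> surj by (auto simp: \<tau>_def fun_eq_iff subset_iff inv_into_into f_inv_into_f)
  then show "word_value H \<sigma> w = word_value H \<sigma> w'"
    using word_identityD[OF assms(2)] hom_word_value by metis
qed

lemma foldr_action_zero_None: "foldr (action_zero \<alpha>) gs None = None"
  by (induction gs) auto

lemma (in group_action) foldr_action_zero:
  assumes "range \<sigma> \<subseteq> carrier G" "x \<in> E"
  shows "foldr (action_zero \<phi>) (map (Some \<circ> \<sigma>) w) (Some x) = Some (\<phi> (word_value G \<sigma> w) x)"
proof (induction w)
  case Nil
  then show ?case using id_eq_one assms(2) by (simp add: fun_eq_iff) (metis restrict_apply')
next
  case (Cons v w)
  interpret group G by (rule group_hom.axioms(1)[OF group_hom])
  have "\<sigma> v \<in> carrier G" "word_value G \<sigma> w \<in> carrier G"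
    using assms(1) word_value_closed by auto
  then show ?case using Cons composition_rule assms(2) by simp
qed

context faithful_action
begin

lemma nonempty_if_nontrivial:
  assumes "carrier G \<noteq> {\<one>}"
  shows "E \<noteq> {}"
proof
  assume "E = {}"
  interpret group G by (rule group_hom.axioms(1)[OF group_hom])
  have "\<phi> g = \<phi> \<one>" if "g \<in> carrier G" for g
    using that bij_prop0 one_closed \<open>E = {}\<close> by (intro extensionalityI[of _ E]) (auto simp: Bij_def)
  then have "g = \<one>" if "g \<in> carrier G" for g
    using that faithful one_closed by (metis inj_onD)
  then show False using assms by auto
qed

lemma foldr_action_zero_eq_if_satisfies_identity:
  assumes "wf_uterm fd_arity s" "wf_uterm fd_arity t"
    and "satisfies_identity (action_algebra G E \<phi>) s t"
    and \<sigma>: "range \<sigma> \<subseteq> carrier G" and "range \<xi> \<subseteq> with_zero E"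
  shows "foldr (action_zero \<phi>) (map (Some \<circ> \<sigma>) (term_word s)) (\<xi> (term_tail s)) =
    foldr (action_zero \<phi>) (map (Some \<circ> \<sigma>) (term_word t)) (\<xi> (term_tail t))"
proof -
  have "range (Some \<circ> \<sigma>) \<subseteq> with_zero (carrier G)" using \<sigma> by (auto simp: with_zero_def)
  then show ?thesis
    using assms(3,5)
    unfolding action_algebra_eq_pair_algebra satisfies_identity_pair_algebra_iff[OF assms(1,2)]
    by blast
qed

context
  fixes s t :: "(fd_symbol, 'v) uterm"
  assumes wf: "wf_uterm fd_arity s" "wf_uterm fd_arity t"
    and identity: "satisfies_identity (action_algebra G E \<phi>) s t"
begin

lemma term_head_eq_if_satisfies_identity: "term_head s = term_head t"
proof (rule term_head_eq_if_satisfies_identity_pair_algebra[OF wf])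
  show "satisfies_identity (pair_algebra (with_zero (carrier G)) (with_zero E) (action_zero \<phi>)) s t"
    using identity by (simp add: action_algebra_eq_pair_algebra)
  interpret group G by (rule group_hom.axioms(1)[OF group_hom])
  show "None \<in> with_zero (carrier G)" "Some \<one> \<in> with_zero (carrier G)" "None \<in> with_zero E"
    by (simp_all add: with_zero_def)
qed simp

lemma term_tail_eq_if_satisfies_identity:
  assumes "E \<noteq> {}"
  shows "term_tail s = term_tail t"
proof (rule ccontr)
  assume neq: "term_tail s \<noteq> term_tail t"
  interpret group G by (rule group_hom.axioms(1)[OF group_hom])
  obtain x where x: "x \<in> E" using assms by blast
  let ?\<xi> = "\<lambda>v. if v = term_tail s then None else Some x"
  have ones: "range (\<lambda>_ :: 'v. \<one>) \<subseteq> carrier G" by auto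
  have "range ?\<xi> \<subseteq> with_zero E" using x by (auto simp: with_zero_def)
  from foldr_action_zero_eq_if_satisfies_identity[OF wf identity ones this]
  show False using neq foldr_action_zero[OF ones x] by (simp add: foldr_action_zero_None)
qed

lemma word_identity_if_satisfies_identity: "word_identity G (term_word s) (term_word t)"
  unfolding word_identity_def
proof (intro allI impI)
  interpret group G by (rule group_hom.axioms(1)[OF group_hom])
  fix \<sigma> :: "'v \<Rightarrow> _" assume \<sigma>: "range \<sigma> \<subseteq> carrier G"
  have closed: "word_value G \<sigma> w \<in> carrier G" for w by (rule word_value_closed[OF \<sigma>])
  have "\<phi> (word_value G \<sigma> (term_word s)) = \<phi> (word_value G \<sigma> (term_word t))"
  proof (rule extensionalityI[of _ E])
    show "\<phi> (word_value G \<sigma> (term_word s)) \<in> extensional E"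
      "\<phi> (word_value G \<sigma> (term_word t)) \<in> extensional E"
      using bij_prop0[OF closed] by (auto simp: Bij_def)
    fix x assume x: "x \<in> E"
    then have "range (\<lambda>_ :: 'v. Some x) \<subseteq> with_zero E" by (auto simp: with_zero_def)
    from foldr_action_zero_eq_if_satisfies_identity[OF wf identity \<sigma> this]
    show "\<phi> (word_value G \<sigma> (term_word s)) x = \<phi> (word_value G \<sigma> (term_word t)) x"
      by (simp add: foldr_action_zero[OF \<sigma> x])
  qed
  then show "word_value G \<sigma> (term_word s) = word_value G \<sigma> (term_word t)"
    using faithful closed by (metis inj_onD)
qed

end

end

section \<open>Counting occurrences by Fourier inversion\<close>

fun count_before :: "'l \<Rightarrow> ('l list \<Rightarrow> bool) \<Rightarrow> 'l list \<Rightarrow> nat" where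
  "count_before l \<Phi> [] = 0"
| "count_before l \<Phi> (x # w) = (if x = l \<and> \<Phi> w then 1 else 0) + count_before l \<Phi> w"

primrec suffix_prod :: "('a, 'm) monoid_scheme \<Rightarrow> 'l \<Rightarrow> ('l list \<Rightarrow> 'a) \<Rightarrow> 'l list \<Rightarrow> 'a" where
  "suffix_prod A l f [] = \<one>\<^bsub>A\<^esub>"
| "suffix_prod A l f (x # w) = (if x = l then f w else \<one>\<^bsub>A\<^esub>) \<otimes>\<^bsub>A\<^esub> suffix_prod A l f w"

lemma suffix_prod_carrier_update: "suffix_prod (A\<lparr>carrier := B\<rparr>) l f w = suffix_prod A l f w"
  by (induction w) auto

lemma (in monoid) suffix_prod_closed:
  "(\<And>v. f v \<in> carrier G) \<Longrightarrow> suffix_prod G l f w \<in> carrier G"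
  by (induction w) auto

lemma (in monoid) suffix_prod_one: "suffix_prod G l (\<lambda>_. \<one>) w = \<one>"
  by (induction w) auto

lemma (in monoid) suffix_prod_indicator:
  assumes "a \<in> carrier G"
  shows "suffix_prod G l (\<lambda>v. if \<Phi> v then a else \<one>) w = a [^] count_before l \<Phi> w"
  by (induction w) (auto simp: assms nat_pow_Suc2[OF assms, simplified] simp del: nat_pow_Suc)

context comm_group
begin

lemma hom_suffix_prod:
  assumes "T \<in> hom G G" "\<And>v. f v \<in> carrier G"
  shows "T (suffix_prod G l f w) = suffix_prod G l (\<lambda>v. T (f v)) w"
proof -
  interpret group_hom G G T
    using assms(1) by (simp add: group_hom_def group_hom_axioms_def is_group)
  show ?thesis by (induction w) (auto simp: assms(2) suffix_prod_closed)
qed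

lemma finprod_suffix_prod:
  assumes "finite I" "\<And>i v. f i v \<in> carrier G"
  shows "finprod G (\<lambda>i. suffix_prod G l (f i) w) I = suffix_prod G l (\<lambda>v. finprod G (\<lambda>i. f i v) I) w"
  by (induction w) (auto simp: finprod_multf assms suffix_prod_closed Pi_def)

lemma suffix_prod_nat_pow:
  assumes "\<And>v. f v \<in> carrier G"
  shows "suffix_prod G l (\<lambda>v. f v [^] (m::nat)) w = suffix_prod G l f w [^] m"
  by (induction w) (auto simp: assms suffix_prod_closed nat_pow_distrib)

lemma eq_if_coprime_nat_pow_eq:
  assumes xy: "x \<in> carrier G" "y \<in> carrier G" and p: "x [^] (p::nat) = \<one>" "y [^] p = \<one>"
    and q: "x [^] (q::nat) = y [^] q" and "coprime p q"
  shows "x = y"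
proof -
  have pow: "(x \<otimes> inv y) [^] (m::nat) = x [^] m \<otimes> inv (y [^] m)" for m
    using xy by (simp add: nat_pow_distrib nat_pow_inv)
  have "(x \<otimes> inv y) [^] p = \<one>" "(x \<otimes> inv y) [^] q = \<one>"
    using pow[of p] pow[of q] p q xy by simp_all
  then have "ord (x \<otimes> inv y) dvd gcd p q" using xy pow_eq_id by simp
  then have "x \<otimes> inv y = \<one>" using \<open>coprime p q\<close> ord_eq_1 xy by simp
  then show ?thesis using xy by (metis inv_equality inv_inv inv_closed)
qed

end

lemma funpow_eq_if_cong:
  "(f ^^ p) x = x \<Longrightarrow> [m = n] (mod p) \<Longrightarrow> (f ^^ m) x = (f ^^ n) x"
  unfolding cong_def by (metis funpow_mod_eq)

text \<open>
  The elements \<open>T\<^sup>j a\<close> play the role of the powers of a nontrivial \<open>q\<close>-th root of unity: their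
  product over a period is \<open>1\<close>. Products of the \<open>T\<^sup>j a\<close> with \<open>j = c \<bullet> k(v)\<close>, for all frequencies
  \<open>c\<close>, therefore determine modulo \<open>p\<close> how often each residue of the vector \<open>k(v)\<close> modulo \<open>q\<close> occurs.
\<close>

locale coprime_periodic_automorphism = comm_group A for A (structure) +
  fixes T :: "'a \<Rightarrow> 'a" and a :: 'a and p q :: nat
  assumes T_hom: "T \<in> hom A A" and a_closed: "a \<in> carrier A" and a_nontrivial: "a \<noteq> \<one>"
    and period: "(T ^^ q) a = a"
    and finprod_period: "finprod A (\<lambda>j. (T ^^ j) a) {..<q} = \<one>"
    and exponent: "x \<in> carrier A \<Longrightarrow> x [^] p = \<one>"
    and prime_p: "prime p" and prime_q: "prime q" and p_neq_q: "p \<noteq> q"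
begin

lemma funpow_T_hom: "T ^^ j \<in> hom A A"
proof (induction j)
  case 0
  show ?case by (simp add: hom_def)
next
  case (Suc j)
  then show ?case using Group.hom_compose[OF _ T_hom] by (simp add: comp_def)
qed

definition translate :: "nat \<Rightarrow> 'a" where
  "translate j = (T ^^ j) a"

lemma translate_closed [simp]: "translate j \<in> carrier A"
  using funpow_T_hom[of j] a_closed by (auto simp: translate_def hom_def)

lemma funpow_T_translate: "(T ^^ i) (translate j) = translate (i + j)"
  by (simp add: translate_def funpow_add)

lemma translate_cong: "[i = j] (mod q) \<Longrightarrow> translate i = translate j"
  unfolding translate_def by (rule funpow_eq_if_cong[OF period])

lemma finprod_translate_progression:
  "finprod A (\<lambda>\<tau>. translate (i + \<tau> * k)) {..<q} = (if q dvd k then translate i [^] q else \<one>)"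
proof (cases "q dvd k")
  case True
  have "translate (i + \<tau> * k) = translate i" for \<tau>
    by (rule translate_cong) (use True in \<open>simp add: cong_add_lcancel_0_nat cong_0_iff\<close>)
  then show ?thesis using True by (simp add: finprod_const)
next
  case False
  let ?residue = "\<lambda>\<tau>. (i + \<tau> * k) mod q"
  have "q > 0" using prime_q prime_gt_0_nat by blast
  have "coprime k q" using False prime_q by (metis coprime_commute prime_imp_coprime)
  have inj: "inj_on ?residue {..<q}"
  proof (rule inj_onI)
    fix x y assume xy: "x \<in> {..<q}" "y \<in> {..<q}" "?residue x = ?residue y"
    then have "[x * k = y * k] (mod q)" by (simp add: cong_def[symmetric] cong_add_lcancel_nat)
    then have "[x = y] (mod q)" using \<open>coprime k q\<close> by (simp add: cong_mult_rcancel_nat)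
    then show "x = y" using xy by (simp add: cong_def)
  qed
  have surj: "?residue ` {..<q} = {..<q}"
    using \<open>q > 0\<close> by (intro endo_inj_surj[OF _ _ inj]) auto
  have "finprod A (\<lambda>\<tau>. translate (i + \<tau> * k)) {..<q} = finprod A (\<lambda>\<tau>. translate (?residue \<tau>)) {..<q}"
    by (intro finprod_cong' translate_cong) (auto simp: cong_def)
  also have "\<dots> = finprod A translate (?residue ` {..<q})"
    by (rule finprod_reindex[symmetric]) (auto simp: inj)
  also have "\<dots> = \<one>" unfolding surj translate_def[abs_def] by (rule finprod_period)
  finally show ?thesis using False by simp
qed

definition masked_translate :: "('v \<Rightarrow> bool) \<Rightarrow> ('v \<Rightarrow> nat) \<Rightarrow> 'v \<Rightarrow> 'a" where
  "masked_translate \<Phi> S v = (if \<Phi> v then translate (S v) else \<one>)"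

lemma masked_translate_closed [simp]: "masked_translate \<Phi> S v \<in> carrier A"
  by (simp add: masked_translate_def)

text \<open>The factor \<open>q - 1\<close> stands for \<open>-1\<close> modulo \<open>q\<close>.\<close>

lemma masked_translate_nat_pow:
  "masked_translate (\<lambda>v. \<Phi> v \<and> [k v = u] (mod q)) S v [^] q =
    finprod A (\<lambda>\<tau>. (T ^^ (\<tau> * (u * (q - 1)))) (masked_translate \<Phi> (\<lambda>v. S v + \<tau> * k v) v)) {..<q}"
proof (cases "\<Phi> v")
  case True
  define m where "m = u * (q - 1)"
  have "q > 0" using prime_q prime_gt_0_nat by blast
  then have "m + u = u * q" unfolding m_def by (cases q) auto
  then have "[m + u = 0] (mod q)" by (simp add: cong_def)
  moreover have "[k v = u] (mod q) \<longleftrightarrow> [m + k v = m + u] (mod q)"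
    by (simp add: cong_add_lcancel_nat)
  ultimately have dvd: "q dvd m + k v \<longleftrightarrow> [k v = u] (mod q)"
    by (metis cong_0_iff cong_sym cong_trans)
  have shift: "\<tau> * m + (S v + \<tau> * k v) = S v + \<tau> * (m + k v)" for \<tau>
    by (simp add: algebra_simps)
  show ?thesis
    using True finprod_translate_progression[of "S v" "m + k v"]
    unfolding m_def[symmetric] by (simp add: masked_translate_def funpow_T_translate shift dvd)
next
  case False
  then show ?thesis
    using hom_one[OF funpow_T_hom] is_group by (simp add: masked_translate_def)
qed

lemma suffix_prod_masked_translate_refine:
  assumes "\<And>\<tau>. suffix_prod A l (masked_translate \<Phi> (\<lambda>v. S v + \<tau> * k v)) w =
      suffix_prod A l (masked_translate \<Phi> (\<lambda>v. S v + \<tau> * k v)) w'"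
  shows "suffix_prod A l (masked_translate (\<lambda>v. \<Phi> v \<and> [k v = u] (mod q)) S) w =
      suffix_prod A l (masked_translate (\<lambda>v. \<Phi> v \<and> [k v = u] (mod q)) S) w'"
    (is "?refined w = ?refined w'")
proof (rule eq_if_coprime_nat_pow_eq)
  have "?refined x [^] q = finprod A (\<lambda>\<tau>. (T ^^ (\<tau> * (u * (q - 1))))
      (suffix_prod A l (masked_translate \<Phi> (\<lambda>v. S v + \<tau> * k v)) x)) {..<q}" for x
  proof -
    have "?refined x [^] q =
        suffix_prod A l (\<lambda>v. masked_translate (\<lambda>v. \<Phi> v \<and> [k v = u] (mod q)) S v [^] q) x"
      by (simp add: suffix_prod_nat_pow)
    also have "\<dots> = finprod A (\<lambda>\<tau>. suffix_prod A l (\<lambda>v. (T ^^ (\<tau> * (u * (q - 1))))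
        (masked_translate \<Phi> (\<lambda>v. S v + \<tau> * k v) v)) x) {..<q}"
      unfolding masked_translate_nat_pow
      by (rule finprod_suffix_prod[symmetric]) (use hom_in_carrier[OF funpow_T_hom] in auto)
    finally show ?thesis by (simp add: hom_suffix_prod[OF funpow_T_hom])
  qed
  then show "?refined w [^] q = ?refined w' [^] q" using assms by simp
  show "coprime p q" using prime_p prime_q p_neq_q primes_coprime by blast
qed (simp_all add: suffix_prod_closed exponent)

lemma suffix_prod_masked_translate_eq:
  fixes n :: nat
  assumes "\<And>c. suffix_prod A l (masked_translate \<Phi> (\<lambda>v. S v + (\<Sum>i<n. c i * k i v))) w =
      suffix_prod A l (masked_translate \<Phi> (\<lambda>v. S v + (\<Sum>i<n. c i * k i v))) w'"
  shows "suffix_prod A l (masked_translate (\<lambda>v. \<Phi> v \<and> (\<forall>i<n. [k i v = u i] (mod q))) S) w =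
      suffix_prod A l (masked_translate (\<lambda>v. \<Phi> v \<and> (\<forall>i<n. [k i v = u i] (mod q))) S) w'"
  using assms
proof (induction n arbitrary: S)
  case 0
  then show ?case by simp
next
  case (Suc n)
  let ?\<Psi> = "\<lambda>v. \<Phi> v \<and> (\<forall>i<n. [k i v = u i] (mod q))"
  have "suffix_prod A l (masked_translate ?\<Psi> (\<lambda>v. S v + \<tau> * k n v)) w =
      suffix_prod A l (masked_translate ?\<Psi> (\<lambda>v. S v + \<tau> * k n v)) w'" for \<tau>
  proof (rule Suc.IH)
    fix c
    have "S v + (\<Sum>i<Suc n. (c(n := \<tau>)) i * k i v) = S v + \<tau> * k n v + (\<Sum>i<n. c i * k i v)" for v
      by simp
    then show "suffix_prod A l (masked_translate \<Phi> (\<lambda>v. S v + \<tau> * k n v + (\<Sum>i<n. c i * k i v))) w =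
        suffix_prod A l (masked_translate \<Phi> (\<lambda>v. S v + \<tau> * k n v + (\<Sum>i<n. c i * k i v))) w'"
      using Suc.prems[of "c(n := \<tau>)"] by presburger
  qed
  from suffix_prod_masked_translate_refine[OF this, of "u n"] show ?case
    by (simp add: less_Suc_eq_le le_less all_conj_distrib imp_disjL conj_assoc)
qed

lemma fourier_inversion:
  fixes n :: nat
  assumes "\<And>c. suffix_prod A l (\<lambda>v. translate (\<Sum>i<n. c i * k i v)) w =
      suffix_prod A l (\<lambda>v. translate (\<Sum>i<n. c i * k i v)) w'"
  shows "[count_before l (\<lambda>v. \<forall>i<n. [k i v = u i] (mod q)) w =
      count_before l (\<lambda>v. \<forall>i<n. [k i v = u i] (mod q)) w'] (mod p)"
proof -
  have "translate 0 [^] count_before l (\<lambda>v. \<forall>i<n. [k i v = u i] (mod q)) w =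
      translate 0 [^] count_before l (\<lambda>v. \<forall>i<n. [k i v = u i] (mod q)) w'"
    using suffix_prod_masked_translate_eq[of l "\<lambda>_. True" "\<lambda>_. 0" k n w w' u] assms
    by (simp add: masked_translate_def[abs_def] suffix_prod_indicator)
  moreover have "translate 0 = a" by (simp add: translate_def)
  moreover have "ord a = p"
    using ord_eq_prime[OF a_closed prime_p] exponent a_closed a_nontrivial by simp
  ultimately show ?thesis using nat_pow_eq_iff_cong[OF a_closed] by simp
qed

end

section \<open>Word identities of a finite nonnilpotent group\<close>

datatype letter = X | Y | Z nat

definition Z_counts_cong :: "nat \<Rightarrow> nat \<Rightarrow> (nat \<Rightarrow> nat) \<Rightarrow> letter list \<Rightarrow> bool" where
  "Z_counts_cong n q u v \<longleftrightarrow> (\<forall>i<n. [count_list v (Z i) = u i] (mod q))"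

text \<open>
  Equivalently, \<open>w\<close> and \<open>w'\<close> have the same value in every wreath product \<open>C\<^sub>p wr C\<^sub>q\<^sup>n\<close> when one of
  \<open>X\<close>, \<open>Y\<close> is sent to a generator of one coordinate of the base, the other one to \<open>1\<close>, and the
  letters \<open>Z i\<close> with \<open>i < n\<close> to the generators of \<open>C\<^sub>q\<^sup>n\<close>.
\<close>

definition counts_cong :: "nat \<Rightarrow> nat \<Rightarrow> letter list \<Rightarrow> letter list \<Rightarrow> bool" where
  "counts_cong p q w w' \<longleftrightarrow>
    (\<forall>i. [count_list w (Z i) = count_list w' (Z i)] (mod q)) \<and>
    (\<forall>n u. \<forall>l\<in>{X, Y}. [count_before l (Z_counts_cong n q u) w =
      count_before l (Z_counts_cong n q u) w'] (mod p))"

context group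
begin

lemma word_value_single:
  assumes "g \<in> carrier G"
  shows "word_value G (\<lambda>v. if v = l then g else \<one>) w = g [^] count_list w l"
  by (induction w) (auto simp: assms nat_pow_Suc2[OF assms, simplified] simp del: nat_pow_Suc)

lemma word_identity_count_list_cong:
  assumes "word_identity G w w'" "g \<in> carrier G"
  shows "[count_list w l = count_list w' l] (mod ord g)"
proof -
  have "range (\<lambda>v. if v = l then g else \<one>) \<subseteq> carrier G" using assms(2) by auto
  from word_identityD[OF assms(1) this] show ?thesis
    using assms(2) by (simp add: word_value_single nat_pow_eq_iff_cong)
qed

lemma word_value_eq_suffix_prod:
  assumes a: "a \<in> carrier G" and g: "g \<in> carrier G" and l: "e l = 0"
  shows "word_value G (\<lambda>v. if v = l then a else inv g [^] (e v :: nat)) w =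
    inv g [^] sum_list (map e w) \<otimes> suffix_prod G l (\<lambda>v. conj_by G (g [^] sum_list (map e v)) a) w"
proof (induction w)
  case (Cons x w)
  let ?c = "sum_list (map e w)" and ?R = "suffix_prod G l (\<lambda>v. conj_by G (g [^] sum_list (map e v)) a)"
  have R: "?R w \<in> carrier G" using a g by (intro suffix_prod_closed) simp
  show ?case
  proof (cases "x = l")
    case True
    have "inv g [^] ?c \<otimes> (conj_by G (g [^] ?c) a \<otimes> ?R w) = a \<otimes> (inv g [^] ?c \<otimes> ?R w)"
      using a g R by (simp add: conj_by_def nat_pow_inv m_assoc[symmetric])
    then show ?thesis using Cons True l by simp
  next
    case False
    then show ?thesis using Cons g R by (simp add: m_assoc[symmetric] nat_pow_mult)
  qed
qed simp

lemma word_identity_suffix_prod_eq: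
  assumes identity: "word_identity G w w'"
    and a: "a \<in> carrier G" and g: "g \<in> carrier G" and l: "e l = (0::nat)"
  shows "suffix_prod G l (\<lambda>v. conj_by G (g [^] sum_list (map e v)) a) w =
    suffix_prod G l (\<lambda>v. conj_by G (g [^] sum_list (map e v)) a) w'"
proof -
  let ?R = "\<lambda>b. suffix_prod G l (\<lambda>v. conj_by G (g [^] sum_list (map e v)) b)"
  have value_eq: "inv g [^] sum_list (map e w) \<otimes> ?R b w = inv g [^] sum_list (map e w') \<otimes> ?R b w'"
    if "b \<in> carrier G" for b
  proof -
    have "range (\<lambda>v. if v = l then b else inv g [^] e v) \<subseteq> carrier G" using that g by auto
    from word_identityD[OF identity this] show ?thesis
      unfolding word_value_eq_suffix_prod[where e = e, OF that g l] .
  qed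
  have "inv g [^] sum_list (map e w) = inv g [^] sum_list (map e w')"
    using value_eq[OF one_closed] g by (simp add: suffix_prod_one)
  moreover have "?R a v \<in> carrier G" for v using a g by (intro suffix_prod_closed) simp
  ultimately show ?thesis using value_eq[OF a] g by simp
qed

end

context coprime_conjugation
begin

lemma prime_dvd_ord: "q dvd ord g"
proof (rule ccontr)
  assume "\<not> q dvd ord g"
  then have "coprime q (ord g)" using prime_q prime_imp_coprime by blast
  then obtain m where "[q * m = 1] (mod ord g)" using cong_solve_coprime_nat by auto
  then have "(g [^] q) [^] m = g"
    using nat_pow_eq_iff_cong[of g "q * m" 1] by (simp add: nat_pow_pow)
  moreover have "(g [^] q) [^] m \<otimes> a = a \<otimes> (g [^] q) [^] m"
    using group_commutes_pow[OF pow_commute] a_in by simp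
  ultimately show False using not_commute by simp
qed

lemma funpow_conj_by: "x \<in> carrier G \<Longrightarrow> (conj_by G g ^^ j) x = conj_by G (g [^] j) x"
  by (induction j) (simp_all add: conj_by_conj_by flip: nat_pow_Suc2)

lemma conj_by_pow_fixed: "conj_by G (g [^] q) a = a"
  using pow_commute a_in by (simp add: conj_by_eq_iff)

lemma finprod_conj_by_commutator:
  "finprod (G\<lparr>carrier := A\<rparr>) (\<lambda>j. (conj_by G g ^^ j) (conj_by G g a \<otimes> inv a)) {..<m}
    = conj_by G (g [^] m) a \<otimes> inv a"
proof -
  interpret A: comm_group "G\<lparr>carrier := A\<rparr>"
    by (rule comm_group_elementary_abelian[OF elementary_abelian])
  let ?t = "\<lambda>j. (conj_by G g ^^ j) (conj_by G g a \<otimes> inv a)"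
  have t_in: "?t j \<in> A" for j using a_in conj_by_in by (simp add: funpow_conj_by)
  have telescope: "?t j = conj_by G (g [^] Suc j) a \<otimes> inv (conj_by G (g [^] j) a)" for j
    using a_in by (simp add: funpow_conj_by conj_by_mult conj_by_inv conj_by_conj_by)
  show ?thesis
  proof (induction m)
    case 0
    then show ?case using a_in by simp
  next
    case (Suc m)
    have "finprod (G\<lparr>carrier := A\<rparr>) ?t {..<Suc m} = ?t m \<otimes> finprod (G\<lparr>carrier := A\<rparr>) ?t {..<m}"
      unfolding lessThan_Suc using A.finprod_insert[of "{..<m}" m ?t] t_in by simp
    also have "\<dots> = conj_by G (g [^] Suc m) a \<otimes> inv (conj_by G (g [^] m) a) \<otimes>
        (conj_by G (g [^] m) a \<otimes> inv a)"
      by (simp only: Suc telescope[of m])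
    also have "\<dots> = conj_by G (g [^] Suc m) a \<otimes> inv a"
      using a_in inv_solve_left'[of "inv a" "conj_by G (g [^] m) a"] by (simp add: m_assoc)
    finally show ?case .
  qed
qed

lemma coprime_periodic_automorphism_conj_by:
  "coprime_periodic_automorphism (G\<lparr>carrier := A\<rparr>) (conj_by G g) (conj_by G g a \<otimes> inv a) p q"
proof (intro coprime_periodic_automorphism.intro coprime_periodic_automorphism_axioms.intro)
  show "comm_group (G\<lparr>carrier := A\<rparr>)" by (rule comm_group_elementary_abelian[OF elementary_abelian])
  show "conj_by G g \<in> hom (G\<lparr>carrier := A\<rparr>) (G\<lparr>carrier := A\<rparr>)"
    using conj_by_in by (auto simp: hom_def conj_by_mult)
  show "conj_by G g a \<otimes> inv a \<in> carrier (G\<lparr>carrier := A\<rparr>)" using a_in conj_by_in by simp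
  show "conj_by G g a \<otimes> inv a \<noteq> \<one>\<^bsub>G\<lparr>carrier := A\<rparr>\<^esub>"
    using conj_by_eq_iff[of g a] not_commute a_in inv_equality[of "conj_by G g a" "inv a"] by auto
  show "(conj_by G g ^^ q) (conj_by G g a \<otimes> inv a) = conj_by G g a \<otimes> inv a"
  proof -
    have "g [^] q \<otimes> g = g \<otimes> g [^] q" using nat_pow_Suc2[of g q] by simp
    then have "conj_by G (g [^] q) (conj_by G g a) = conj_by G g (conj_by G (g [^] q) a)"
      using a_in by (simp add: conj_by_conj_by)
    then show ?thesis
      using a_in by (simp add: funpow_conj_by conj_by_mult conj_by_inv conj_by_pow_fixed)
  qed
  show "finprod (G\<lparr>carrier := A\<rparr>) (\<lambda>j. (conj_by G g ^^ j) (conj_by G g a \<otimes> inv a)) {..<q}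
      = \<one>\<^bsub>G\<lparr>carrier := A\<rparr>\<^esub>"
    using a_in by (simp add: finprod_conj_by_commutator conj_by_pow_fixed)
  show "x [^]\<^bsub>G\<lparr>carrier := A\<rparr>\<^esub> p = \<one>\<^bsub>G\<lparr>carrier := A\<rparr>\<^esub>" if "x \<in> carrier (G\<lparr>carrier := A\<rparr>)" for x
    using that elementary_abelian nat_pow_consistent[of x p A] by (simp add: elementary_abelian_def)
  show "prime p" "prime q" "p \<noteq> q"
    using elementary_abelian prime_q p_neq_q by (auto simp: elementary_abelian_def)
qed

lemma word_identity_count_before_cong:
  assumes "word_identity G w w'" "\<And>i. l \<noteq> Z i"
  shows "[count_before l (Z_counts_cong n q u) w = count_before l (Z_counts_cong n q u) w'] (mod p)"
  unfolding Z_counts_cong_def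
proof -
  let ?b = "conj_by G g a \<otimes> inv a"
  interpret periodic: coprime_periodic_automorphism "G\<lparr>carrier := A\<rparr>" "conj_by G g" ?b p q
    by (rule coprime_periodic_automorphism_conj_by)
  have b: "?b \<in> carrier G" using a_in by simp
  show "[count_before l (\<lambda>v. \<forall>i<n. [count_list v (Z i) = u i] (mod q)) w =
      count_before l (\<lambda>v. \<forall>i<n. [count_list v (Z i) = u i] (mod q)) w'] (mod p)"
  proof (rule periodic.fourier_inversion)
    fix c :: "nat \<Rightarrow> nat"
    define e where "e v = (case v of Z i \<Rightarrow> if i < n then c i else 0 | _ \<Rightarrow> 0)" for v
    have "e l = 0" using assms(2) by (cases l) (auto simp: e_def)
    have "sum_list (map e v) = (\<Sum>i<n. c i * count_list v (Z i))" for v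
    proof (induction v)
      case (Cons x v)
      have "(\<Sum>i<n. c i * count_list (x # v) (Z i)) =
          (\<Sum>i<n. (if x = Z i then c i else 0) + c i * count_list v (Z i))"
        by (intro sum.cong) auto
      also have "\<dots> = e x + (\<Sum>i<n. c i * count_list v (Z i))"
        by (cases x) (simp_all add: e_def sum.distrib)
      finally show ?case using Cons by simp
    qed simp
    then show "suffix_prod (G\<lparr>carrier := A\<rparr>) l
          (\<lambda>v. periodic.translate (\<Sum>i<n. c i * count_list v (Z i))) w =
        suffix_prod (G\<lparr>carrier := A\<rparr>) l
          (\<lambda>v. periodic.translate (\<Sum>i<n. c i * count_list v (Z i))) w'"
      using word_identity_suffix_prod_eq[where e = e, OF assms(1) b g_closed \<open>e l = 0\<close>] b
      by (simp add: suffix_prod_carrier_update periodic.translate_def funpow_conj_by)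
  qed
qed

lemma word_identity_counts_cong:
  assumes "word_identity G w w'"
  shows "counts_cong p q w w'"
  unfolding counts_cong_def
  using word_identity_count_before_cong[OF assms]
    cong_dvd_modulus_nat[OF word_identity_count_list_cong[OF assms g_closed] prime_dvd_ord]
  by auto

end

lemma (in group) nonnilpotent_word_identity_counts_cong:
  assumes "finite (carrier G)" "\<not> nilpotent_group G"
  obtains p q where "prime p" "prime q" "\<And>w w'. word_identity G w w' \<Longrightarrow> counts_cong p q w w'"
proof -
  obtain H where H: "subgroup H G" "\<not> nilpotent_group (G\<lparr>carrier := H\<rparr>)"
    "proper_subgroups_nilpotent (G\<lparr>carrier := H\<rparr>)"
    using minimal_nonnilpotent_subgroup_exists[OF assms] .
  let ?H = "G\<lparr>carrier := H\<rparr>"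
  interpret H: group ?H by (rule subgroup_imp_group[OF H(1)])
  have finH: "finite (carrier ?H)" using finite_subset[OF subgroup.subset[OF H(1)] assms(1)] by simp
  obtain M where M: "M \<lhd> ?H" "carrier (?H Mod M) \<noteq> {\<one>\<^bsub>?H Mod M\<^esub>}"
    "center (?H Mod M) = {\<one>\<^bsub>?H Mod M\<^esub>}"
    using H.centerless_nontrivial_quotient_exists[OF finH H(2)] .
  interpret proj: group_hom ?H "?H Mod M" "(#>\<^bsub>?H\<^esub>) M" by (rule normal.group_hom_Mod[OF M(1)])
  have surj: "(#>\<^bsub>?H\<^esub>) M ` carrier ?H = carrier (?H Mod M)" by (rule image_r_coset_Mod)
  have "finite (carrier (?H Mod M))" unfolding surj[symmetric] using finH by (rule finite_imageI)
  from proj.H.coprime_conjugation_exists[OF this M(2,3)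
      proj.proper_subgroups_nilpotent_image[OF surj H(3)]]
  obtain A p q g a where "coprime_conjugation A (?H Mod M) p q g a" .
  then interpret conjugation: coprime_conjugation A "?H Mod M" p q g a .
  have "counts_cong p q w w'" if "word_identity G w w'" for w w'
    by (rule conjugation.word_identity_counts_cong[OF
          proj.word_identity_image[OF surj word_identity_subgroup[OF H(1) that]]])
  then show thesis
    using that conjugation.prime_q conjugation.elementary_abelian
    by (auto simp: elementary_abelian_def)
qed

section \<open>A large transitive action by few letters\<close>

definition letters :: "nat \<Rightarrow> letter set" where
  "letters n = {X, Y} \<union> Z ` {..<n}"

lemma finite_letters: "finite (letters n)"
  by (simp add: letters_def)

lemma card_letters: "card (letters n) = n + 2"
proof -
  have "card (Z ` {..<n}) = n" by (simp add: card_image inj_on_def)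
  then show ?thesis unfolding letters_def by (subst card_Un_disjoint) auto
qed

lemma count_before_eq_0_if_notin: "l \<notin> set w \<Longrightarrow> count_before l \<Phi> w = 0"
  by (induction w) auto

lemma count_before_eq_0_if_never:
  "(\<And>v. set v \<subseteq> set w \<Longrightarrow> \<not> \<Phi> v) \<Longrightarrow> count_before l \<Phi> w = 0"
proof (induction w)
  case (Cons x w)
  have "\<not> \<Phi> w" by (rule Cons.prems) auto
  moreover have "count_before l \<Phi> w = 0" by (rule Cons.IH, rule Cons.prems) auto
  ultimately show ?case by simp
qed simp

text \<open>
  The action of the wreath product of \<open>\<langle>s, t\<rangle>\<close> with \<open>C\<^sub>q\<^sup>n\<close> on \<open>{..<N} \<times> C\<^sub>q\<^sup>n\<close>: the letter \<open>Z i\<close>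
  is the \<open>i\<close>-th generator of \<open>C\<^sub>q\<^sup>n\<close>, and \<open>X\<close> and \<open>Y\<close> are \<open>s\<close> at the coordinate \<open>0\<close> and \<open>t\<close> at
  the coordinate \<open>(1,\<dots>,1)\<close>.
\<close>

locale wreath_action =
  fixes n q p N :: nat and s t :: "nat \<Rightarrow> nat"
  assumes q_ge_2: "q \<ge> 2" and N_pos: "N > 0"
    and s_less: "k < N \<Longrightarrow> s k < N" and t_less: "k < N \<Longrightarrow> t k < N"
    and s_period: "k < N \<Longrightarrow> (s ^^ p) k = k" and t_period: "k < N \<Longrightarrow> (t ^^ p) k = k"
    and s_or_t_Suc: "Suc k < N \<Longrightarrow> s k = Suc k \<or> t k = Suc k"
begin

definition states :: "(nat \<times> (nat \<Rightarrow> nat)) set" where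
  "states = {..<N} \<times> ({..<n} \<rightarrow>\<^sub>E {..<q})"

fun act :: "letter \<Rightarrow> nat \<times> (nat \<Rightarrow> nat) \<Rightarrow> nat \<times> (nat \<Rightarrow> nat)" where
  "act X (k, u) = (if \<forall>i<n. u i = 0 then s k else k, u)"
| "act Y (k, u) = (if \<forall>i<n. u i = 1 then t k else k, u)"
| "act (Z i) (k, u) = (k, u(i := (u i + 1) mod q))"

definition origin :: "nat \<times> (nat \<Rightarrow> nat)" where
  "origin = (0, \<lambda>i\<in>{..<n}. 0)"

definition letter_algebra :: "(fd_symbol, letter \<times> nat \<times> (nat \<Rightarrow> nat)) ualgebra" where
  "letter_algebra = pair_algebra (letters n) states act"

lemma act_in_states: "l \<in> letters n \<Longrightarrow> r \<in> states \<Longrightarrow> act l r \<in> states"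
  using q_ge_2 s_less t_less
  by (cases r; cases l) (auto simp: states_def letters_def PiE_iff extensional_def)

lemma foldr_act_in_states: "set w \<subseteq> letters n \<Longrightarrow> r \<in> states \<Longrightarrow> foldr act w r \<in> states"
  by (induction w) (auto intro: act_in_states)

lemma finite_states: "finite states"
  unfolding states_def by (intro finite_cartesian_product finite_PiE) auto

lemma le_card_states: "N \<le> card states"
proof -
  have "card ({..<n} \<rightarrow>\<^sub>E {..<q}) > 0" using q_ge_2 by (simp add: card_PiE)
  then show ?thesis by (simp add: states_def card_cartesian_product)
qed

lemma origin_in_states: "origin \<in> states"
  using N_pos q_ge_2 by (auto simp: origin_def states_def)

abbreviation reachable_states :: "(nat \<times> (nat \<Rightarrow> nat)) set" where
  "reachable_states \<equiv> reachable (letters n) act origin"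

lemma reachable_shift_coordinate:
  assumes "(k, u) \<in> reachable_states" "i < n" "u i < q"
  shows "(k, u(i := (u i + m) mod q)) \<in> reachable_states"
proof (induction m)
  case 0
  then show ?case using assms by simp
next
  case (Suc m)
  have "u(i := (u i + m) mod q, i := ((u i + m) mod q + 1) mod q) = u(i := (u i + Suc m) mod q)"
    by (simp add: mod_simps)
  moreover have "Z i \<in> letters n" using assms(2) by (simp add: letters_def)
  ultimately show ?case using reachable.step[OF _ Suc] by (metis act.simps(3) fun_upd_same)
qed

lemma reachable_update_coordinate:
  assumes "(k, u) \<in> reachable_states" "i < n" "u i < q" "v < q"
  shows "(k, u(i := v)) \<in> reachable_states"
  using reachable_shift_coordinate[OF assms(1-3), of "v + q - u i"] assms(3,4) by simp

lemma reachable_change_coordinates: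
  assumes "(k, u) \<in> reachable_states"
    and u: "u \<in> {..<n} \<rightarrow>\<^sub>E {..<q}" "u' \<in> {..<n} \<rightarrow>\<^sub>E {..<q}"
  shows "(k, u') \<in> reachable_states"
proof -
  have "(k, \<lambda>i. if i < j then u' i else u i) \<in> reachable_states" if "j \<le> n" for j
    using that
  proof (induction j)
    case 0
    then show ?case using assms(1) by simp
  next
    case (Suc j)
    have "(k, (\<lambda>i. if i < j then u' i else u i)(j := u' j)) \<in> reachable_states"
      using Suc u by (intro reachable_update_coordinate) (auto simp: PiE_iff)
    moreover have "(\<lambda>i. if i < j then u' i else u i)(j := u' j) = (\<lambda>i. if i < Suc j then u' i else u i)"
      by (auto simp: less_Suc_eq)
    ultimately show ?case by simp
  qed
  from this[of n] have "(k, \<lambda>i. if i < n then u' i else u i) \<in> reachable_states" by simp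
  moreover have "(\<lambda>i. if i < n then u' i else u i) = u'"
    using u by (auto simp: PiE_iff extensional_def)
  ultimately show ?thesis by simp
qed

lemma reachable_first_component:
  assumes "k < N"
  shows "(k, \<lambda>i\<in>{..<n}. 0) \<in> reachable_states"
  using assms
proof (induction k)
  case 0
  show ?case unfolding origin_def by (rule reachable.start)
next
  case (Suc k)
  let ?zeros = "\<lambda>i\<in>{..<n}. 0 :: nat" and ?ones = "\<lambda>i\<in>{..<n}. 1 :: nat"
  have vectors: "?zeros \<in> {..<n} \<rightarrow>\<^sub>E {..<q}" "?ones \<in> {..<n} \<rightarrow>\<^sub>E {..<q}" using q_ge_2 by auto
  have zeros: "(k, ?zeros) \<in> reachable_states" by (rule Suc.IH[OF Suc_lessD[OF Suc.prems]])
  have XY: "X \<in> letters n" "Y \<in> letters n" by (simp_all add: letters_def)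
  from s_or_t_Suc[OF Suc.prems] show ?case
  proof
    assume "s k = Suc k"
    then have "act X (k, ?zeros) = (Suc k, ?zeros)" by simp
    then show ?thesis using reachable.step[OF XY(1) zeros] by metis
  next
    assume "t k = Suc k"
    then have "act Y (k, ?ones) = (Suc k, ?ones)" by simp
    then have "(Suc k, ?ones) \<in> reachable_states"
      using reachable.step[OF XY(2) reachable_change_coordinates[OF zeros vectors]] by metis
    then show ?thesis by (rule reachable_change_coordinates[OF _ vectors(2,1)])
  qed
qed

lemma states_subset_reachable: "states \<subseteq> reachable_states"
proof
  fix r assume "r \<in> states"
  then obtain k u where "r = (k, u)" "k < N" "u \<in> {..<n} \<rightarrow>\<^sub>E {..<q}" by (auto simp: states_def)
  moreover have "(\<lambda>i\<in>{..<n}. 0) \<in> {..<n} \<rightarrow>\<^sub>E {..<q}" using q_ge_2 by auto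
  ultimately show "r \<in> reachable_states"
    using reachable_change_coordinates reachable_first_component by blast
qed

lemma is_ualgebra_letter_algebra: "is_ualgebra fd_arity letter_algebra"
  unfolding letter_algebra_def
  using act_in_states origin_in_states by (intro is_ualgebra_pair_algebra) (auto simp: letters_def)

lemma generated_by_at_most_letter_algebra: "generated_by_at_most fd_arity letter_algebra (n + 2)"
  unfolding letter_algebra_def card_letters[symmetric]
  by (rule generated_by_at_most_pair_algebra[OF finite_letters _ origin_in_states act_in_states
        states_subset_reachable]) (auto simp: letters_def)

lemma finite_universe_letter_algebra: "finite (universe letter_algebra)"
  by (simp add: letter_algebra_def pair_algebra_def finite_letters finite_states)

lemma le_card_universe_letter_algebra: "N \<le> card (universe letter_algebra)"
proof -
  have "card states \<le> (n + 2) * card states" by simp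
  then show ?thesis
    using le_card_states
    by (simp add: letter_algebra_def pair_algebra_def card_cartesian_product card_letters)
qed

lemma snd_foldr_act:
  assumes "set w \<subseteq> letters n" "(k, u) \<in> states" "i < n"
  shows "snd (foldr act w (k, u)) i = (u i + count_list w (Z i)) mod q"
  using assms(1)
proof (induction w)
  case Nil
  then show ?case using assms by (auto simp: states_def PiE_iff)
next
  case (Cons l w)
  obtain k' u' where "foldr act w (k, u) = (k', u')" by (cases "foldr act w (k, u)")
  then show ?case using Cons by (cases l) (auto simp: mod_simps)
qed

definition hits :: "letter \<Rightarrow> nat \<Rightarrow> (nat \<Rightarrow> nat) \<Rightarrow> letter list \<Rightarrow> nat" where
  "hits l c u = count_before l (\<lambda>v. \<forall>i<n. (u i + count_list v (Z i)) mod q = c)"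

lemma fst_foldr_act:
  assumes "set w \<subseteq> letters n" "(k, u) \<in> states"
  shows "hits Y 1 u w = 0 \<Longrightarrow> fst (foldr act w (k, u)) = (s ^^ hits X 0 u w) k"
    and "hits X 0 u w = 0 \<Longrightarrow> fst (foldr act w (k, u)) = (t ^^ hits Y 1 u w) k"
proof -
  have "(hits Y 1 u w = 0 \<longrightarrow> fst (foldr act w (k, u)) = (s ^^ hits X 0 u w) k) \<and>
    (hits X 0 u w = 0 \<longrightarrow> fst (foldr act w (k, u)) = (t ^^ hits Y 1 u w) k)"
    using assms(1)
  proof (induction w)
    case Nil
    then show ?case by (simp add: hits_def)
  next
    case (Cons l w)
    obtain k' u' where r: "foldr act w (k, u) = (k', u')" by (cases "foldr act w (k, u)")
    have "\<forall>i<n. u' i = (u i + count_list w (Z i)) mod q"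
      using snd_foldr_act[of w k u] r Cons.prems assms(2) by auto
    then show ?case using Cons r by (cases l) (auto simp: hits_def)
  qed
  then show "hits Y 1 u w = 0 \<Longrightarrow> fst (foldr act w (k, u)) = (s ^^ hits X 0 u w) k"
    and "hits X 0 u w = 0 \<Longrightarrow> fst (foldr act w (k, u)) = (t ^^ hits Y 1 u w) k"
    by auto
qed

lemma hits_eq_count_before_Z_counts_cong:
  assumes "\<And>i. i < n \<Longrightarrow> u i < q" "c < q"
  shows "hits l c u = count_before l (Z_counts_cong n q (\<lambda>i. q - u i + c))"
proof -
  have "(u i + m) mod q = c \<longleftrightarrow> [m = q - u i + c] (mod q)" if "i < n" for i m
  proof -
    have "(u i + m) mod q = c \<longleftrightarrow> [u i + m = u i + (q - u i + c)] (mod q)"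
      using assms(1)[OF that] assms(2) by (simp add: cong_def)
    then show ?thesis by (simp add: cong_add_lcancel_nat)
  qed
  then show ?thesis unfolding hits_def Z_counts_cong_def by (metis (no_types, lifting))
qed

text \<open>
  If \<open>Z i\<close> does not occur, then \<open>u i\<close> stays constant, and \<open>X\<close> requires it to be \<open>0\<close> but \<open>Y\<close> to be \<open>1\<close>.
\<close>

lemma hits_X_or_hits_Y_eq_0:
  assumes "L \<subset> letters n" "\<And>i. i < n \<Longrightarrow> u i < q"
  shows "(\<forall>w. set w \<subseteq> L \<longrightarrow> hits X 0 u w = 0) \<or> (\<forall>w. set w \<subseteq> L \<longrightarrow> hits Y 1 u w = 0)"
proof -
  obtain l where l: "l \<in> letters n" "l \<notin> L" using assms(1) by blast
  show ?thesis
  proof (cases l)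
    case X
    then show ?thesis using l(2) by (auto simp: hits_def intro!: count_before_eq_0_if_notin)
  next
    case Y
    then show ?thesis using l(2) by (auto simp: hits_def intro!: count_before_eq_0_if_notin)
  next
    case (Z i)
    then have i: "i < n" using l(1) by (auto simp: letters_def)
    have "hits l' c u w = 0" if "set w \<subseteq> L" "u i \<noteq> c" for l' c w
      unfolding hits_def
    proof (rule count_before_eq_0_if_never)
      fix v assume "set v \<subseteq> set w"
      then have "count_list v (Z i) = 0" using that(1) l(2) Z by (auto simp: count_list_0_iff)
      then show "\<not> (\<forall>i<n. (u i + count_list v (Z i)) mod q = c)"
        using i assms(2)[OF i] that(2) by auto
    qed
    then show ?thesis by (metis zero_neq_one)
  qed
qed

lemma fst_foldr_act_eq:
  assumes w: "set w \<subseteq> L" "set w' \<subseteq> L" and L: "L \<subset> letters n"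
    and state: "(k, u) \<in> states" and cong: "counts_cong p q w w'"
  shows "fst (foldr act w (k, u)) = fst (foldr act w' (k, u))"
proof -
  have k: "k < N" and u: "\<And>i. i < n \<Longrightarrow> u i < q"
    using state by (auto simp: states_def PiE_iff)
  have hits: "[hits l c u w = hits l c u w'] (mod p)" if "l \<in> {X, Y}" "c < q" for l c
    using cong that(1) hits_eq_count_before_Z_counts_cong[of u, OF u that(2)]
    by (auto simp: counts_cong_def)
  from hits_X_or_hits_Y_eq_0[OF L u] show ?thesis
  proof
    assume "\<forall>w. set w \<subseteq> L \<longrightarrow> hits X 0 u w = 0"
    then have "fst (foldr act v (k, u)) = (t ^^ hits Y 1 u v) k" if "set v \<subseteq> L" for v
      using fst_foldr_act(2)[OF _ state] that L by blast
    moreover have "(t ^^ hits Y 1 u w) k = (t ^^ hits Y 1 u w') k"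
      using funpow_eq_if_cong[OF t_period[OF k] hits] q_ge_2 by simp
    ultimately show ?thesis using w by simp
  next
    assume "\<forall>w. set w \<subseteq> L \<longrightarrow> hits Y 1 u w = 0"
    then have "fst (foldr act v (k, u)) = (s ^^ hits X 0 u v) k" if "set v \<subseteq> L" for v
      using fst_foldr_act(1)[OF _ state] that L by blast
    moreover have "(s ^^ hits X 0 u w) k = (s ^^ hits X 0 u w') k"
      using funpow_eq_if_cong[OF s_period[OF k] hits] q_ge_2 by simp
    ultimately show ?thesis using w by simp
  qed
qed

lemma snd_foldr_act_eq:
  assumes w: "set w \<subseteq> letters n" "set w' \<subseteq> letters n"
    and state: "(k, u) \<in> states" and cong: "counts_cong p q w w'"
  shows "snd (foldr act w (k, u)) = snd (foldr act w' (k, u))"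
proof (rule extensionalityI)
  show "snd (foldr act w (k, u)) \<in> extensional {..<n}" "snd (foldr act w' (k, u)) \<in> extensional {..<n}"
    using foldr_act_in_states[OF w(1) state] foldr_act_in_states[OF w(2) state]
    by (auto simp: states_def PiE_iff mem_Times_iff)
  fix i assume "i \<in> {..<n}"
  then have i: "i < n" by simp
  have "[u i + count_list w (Z i) = u i + count_list w' (Z i)] (mod q)"
    using cong by (intro cong_add) (auto simp: counts_cong_def)
  then show "snd (foldr act w (k, u)) i = snd (foldr act w' (k, u)) i"
    using snd_foldr_act[OF w(1) state i] snd_foldr_act[OF w(2) state i] by (simp add: cong_def)
qed

lemma foldr_act_eq:
  assumes "set w \<subseteq> L" "set w' \<subseteq> L" "L \<subset> letters n" "r \<in> states" "counts_cong p q w w'"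
  shows "foldr act w r = foldr act w' r"
proof -
  obtain k u where r: "r = (k, u)" by (cases r)
  have "set w \<subseteq> letters n" "set w' \<subseteq> letters n" using assms(1-3) by auto
  then show ?thesis
    unfolding r using assms(4,5) fst_foldr_act_eq[OF assms(1-3)] snd_foldr_act_eq
    by (intro prod_eqI) (simp_all add: r)
qed

lemma satisfies_identity_letter_algebra:
  fixes lhs rhs :: "(fd_symbol, 'v) uterm"
  assumes wf: "wf_uterm fd_arity lhs" "wf_uterm fd_arity rhs"
    and card: "card (uterm_vars lhs \<union> uterm_vars rhs) \<le> n"
    and "term_head lhs = term_head rhs" "term_tail lhs = term_tail rhs"
    and cong: "\<And>\<gamma>. counts_cong p q (map \<gamma> (term_word lhs)) (map \<gamma> (term_word rhs))"
  shows "satisfies_identity letter_algebra lhs rhs"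
  unfolding letter_algebra_def satisfies_identity_pair_algebra_iff[OF wf]
proof (intro allI impI conjI)
  fix \<gamma> :: "'v \<Rightarrow> letter" and \<xi> :: "'v \<Rightarrow> nat \<times> (nat \<Rightarrow> nat)"
  assume \<gamma>: "range \<gamma> \<subseteq> letters n" and \<xi>: "range \<xi> \<subseteq> states"
  show "\<gamma> (term_head lhs) = \<gamma> (term_head rhs)" using assms(4) by simp
  let ?V = "uterm_vars lhs \<union> uterm_vars rhs"
  have "card (\<gamma> ` ?V) \<le> n"
    using card card_image_le[of ?V \<gamma>] finite_uterm_vars by (metis finite_Un le_trans)
  then have "\<gamma> ` ?V \<noteq> letters n" using card_letters[of n] by auto
  then have "\<gamma> ` ?V \<subset> letters n" using \<gamma> by auto
  moreover have "set (map \<gamma> (term_word lhs)) \<subseteq> \<gamma> ` ?V" "set (map \<gamma> (term_word rhs)) \<subseteq> \<gamma> ` ?V"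
    using set_term_word_subset[OF wf(1)] set_term_word_subset[OF wf(2)] by auto
  moreover have "\<xi> (term_tail lhs) \<in> states" using \<xi> by auto
  ultimately show "foldr act (map \<gamma> (term_word lhs)) (\<xi> (term_tail lhs)) =
      foldr act (map \<gamma> (term_word rhs)) (\<xi> (term_tail rhs))"
    using foldr_act_eq cong assms(5) by metis
qed

lemma in_variety_upto_letter_algebra:
  assumes "faithful_action G S \<alpha>" "S \<noteq> {}"
    and "\<And>w w'. word_identity G w w' \<Longrightarrow> counts_cong p q w w'"
  shows "in_variety_upto fd_arity n (action_algebra G S \<alpha>) letter_algebra"
  unfolding in_variety_upto_def
proof (intro conjI allI impI is_ualgebra_letter_algebra)
  fix lhs rhs :: "(fd_symbol, nat) uterm"
  assume "wf_uterm fd_arity lhs \<and> wf_uterm fd_arity rhs \<and>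
      card (uterm_vars lhs \<union> uterm_vars rhs) \<le> n \<and> satisfies_identity (action_algebra G S \<alpha>) lhs rhs"
  then have wf: "wf_uterm fd_arity lhs" "wf_uterm fd_arity rhs"
    and card: "card (uterm_vars lhs \<union> uterm_vars rhs) \<le> n"
    and identity: "satisfies_identity (action_algebra G S \<alpha>) lhs rhs" by simp_all
  interpret faithful_action G S \<alpha> by (rule assms(1))
  show "satisfies_identity letter_algebra lhs rhs"
    by (rule satisfies_identity_letter_algebra[OF wf card
          term_head_eq_if_satisfies_identity[OF wf identity]
          term_tail_eq_if_satisfies_identity[OF wf identity assms(2)]
          assms(3)[OF word_identity_map[OF word_identity_if_satisfies_identity[OF wf identity]]]])
qed

end

section \<open>Two permutations of order \<open>p\<close> with a long orbit\<close>

definition block_rotation :: "nat \<Rightarrow> nat \<Rightarrow> nat" where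
  "block_rotation p k = p * (k div p) + Suc k mod p"

lemma funpow_block_rotation: "p > 0 \<Longrightarrow> (block_rotation p ^^ m) k = p * (k div p) + (k + m) mod p"
  by (induction m) (auto simp: block_rotation_def mod_simps)

lemma block_rotation_less:
  assumes "k < p * l"
  shows "block_rotation p k < p * l"
proof -
  have "p > 0" using assms by (cases p) auto
  have "k div p < l" using assms by (simp add: less_mult_imp_div_less mult.commute)
  then have "p * (k div p + 1) \<le> p * l" by (intro mult_le_mono2) simp
  moreover have "Suc k mod p < p" using \<open>p > 0\<close> by simp
  ultimately show ?thesis unfolding block_rotation_def by (simp add: algebra_simps)
qed

lemma block_rotation_Suc_cases:
  assumes "p \<ge> 2"
  obtains "block_rotation p k = Suc k" | j where "k = Suc j" "block_rotation p j = Suc j"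
proof (cases "Suc k mod p = 0")
  case False
  then have "block_rotation p k = Suc k" by (auto simp: block_rotation_def mod_Suc split: if_splits)
  then show thesis by (rule that(1))
next
  case True
  then have "k \<noteq> 0" using assms by (cases k) auto
  then obtain j where j: "k = Suc j" by (cases k) auto
  then have "Suc j mod p \<noteq> 0" using True assms by (auto simp: mod_Suc split: if_splits)
  then have "block_rotation p j = Suc j" by (auto simp: block_rotation_def mod_Suc split: if_splits)
  then show thesis by (rule that(2)[OF j])
qed

text \<open>
  Both permutations rotate \<open>l\<close> consecutive blocks of length \<open>p\<close>; those of the second one start one
  place later, so that it joins the blocks of the first.
\<close>

lemma wreath_action_block_rotation:
  assumes "q \<ge> 2" "p \<ge> 2"
  shows "wreath_action q p (Suc (p * l)) (\<lambda>k. if k < p * l then block_rotation p k else k)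
    (case_nat 0 (\<lambda>k. Suc (block_rotation p k)))" (is "wreath_action q p ?N ?s ?t")
proof
  have rotation_period: "(block_rotation p ^^ p) k = k" for k
    using assms(2) by (simp add: funpow_block_rotation)
  have rotation_less: "(block_rotation p ^^ m) k < p * l" if "k < p * l" for m k
    by (induction m) (auto simp: that block_rotation_less)
  have s_funpow: "(?s ^^ m) k = (if k < p * l then (block_rotation p ^^ m) k else k)" for m k
    by (induction m) (auto simp: rotation_less)
  have t_funpow: "(?t ^^ m) k = case_nat 0 (\<lambda>k. Suc ((block_rotation p ^^ m) k)) k" for m k
    by (induction m) (auto split: nat.split)
  fix k
  show "?s k < ?N" "?t k < ?N" if "k < ?N"
    using that block_rotation_less by (auto simp: less_SucI split: nat.split)
  show "(?s ^^ p) k = k" "(?t ^^ p) k = k"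
    unfolding s_funpow t_funpow rotation_period by (auto split: nat.split)
  show "?s k = Suc k \<or> ?t k = Suc k" if "Suc k < ?N"
    using that by (cases k rule: block_rotation_Suc_cases[OF assms(2)]) auto
qed (use assms in auto)

section \<open>The algebra of a faithful action of a nonnilpotent group\<close>

theorem theorem5p2:
  fixes G :: "('g, 'm) monoid_scheme" and S :: "'s set" and \<alpha> :: "'g \<Rightarrow> 's \<Rightarrow> 's"
  assumes "group G" and "finite (carrier G)" and "\<not> nilpotent_group G"
    and "finite S" and "faithful_action G S \<alpha>"
  shows "inherently_nonfinitely_based_in_finite_sense fd_arity (action_algebra G S \<alpha>)"
proof (rule inherently_nonfinitely_based_in_finite_senseI)
  interpret group G by fact
  have "carrier G \<noteq> {\<one>\<^bsub>G\<^esub>}" using nilpotent_group_if_trivial assms(3) by blast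
  then have S: "S \<noteq> {}" using faithful_action.nonempty_if_nontrivial assms(5) by blast
  obtain p q where p: "prime p" and q: "prime q"
    and counts: "\<And>w w'. word_identity G w w' \<Longrightarrow> counts_cong p q w w'"
    using nonnilpotent_word_identity_counts_cong[OF assms(2,3)] by blast
  show "1 \<le> n + 2" for n :: nat by simp
  fix n l :: nat
  interpret wreath_action n q p "Suc (p * l)" "\<lambda>k. if k < p * l then block_rotation p k else k"
    "case_nat 0 (\<lambda>k. Suc (block_rotation p k))"
    by (rule wreath_action_block_rotation[OF prime_ge_2_nat[OF q] prime_ge_2_nat[OF p]])
  have "l \<le> p * l" using prime_ge_1_nat[OF p] by simp
  then have "l \<le> card (universe letter_algebra)" using le_card_universe_letter_algebra by linarith
  then show "\<exists>B :: (fd_symbol, letter \<times> nat \<times> (nat \<Rightarrow> nat)) ualgebra.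
      in_variety_upto fd_arity n (action_algebra G S \<alpha>) B \<and> finite (universe B) \<and>
      generated_by_at_most fd_arity B (n + 2) \<and> l \<le> card (universe B)"
    using in_variety_upto_letter_algebra[OF assms(5) S counts] finite_universe_letter_algebra
      generated_by_at_most_letter_algebra by blast
qed

end
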